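(* Fix $y\in\mathbb{R}^d$, an integer $k\ge 0$, and a measurable $g:\mathbb{R}^d\to\mathbb{R}$. Let $X,V$ be independent $\mathbb{R}^d$-valued random vectors, $Y=X+V$, where $P_V$ has a Lebesgue density $f_V\in C_0^k(\mathbb{R}^d;\mathbb{R})$ and $\varphi_V(\omega)\ne 0$ for Lebesgue-a.e. $\omega$. Let $\lambda_{g,V,y}(x)=g(x)f_V(y-x)$ and assume $\lambda_{g,V,y}\in\Xi^0(\mathbb{R}^d;\mathbb{C})$ and $\widetilde{\lambda}_{g,V,y}\in L^1(\mathbb{R}^d;\mathbb{C})$. Define $\mathcal{Q}_{g,V,y}(\omega)=\widetilde{\lambda}_{g,V,y}(\omega)/\varphi_V(-\omega)$ if $\varphi_V(-\omega)\neq 0$ and $\mathcal{Q}_{g,V,y}(\omega)=0$ otherwise. Assume further: (i) there exists $N\in\mathbb{N}_0$ with $\int_{\mathbb{R}^d}|\mathcal{Q}_{g,V,y}(\omega)|(1+\|\omega\|_2)^{-N}\,d\omega<\infty$ (so that $\mathcal{I}_{\mathcal{Q}_{g,V,y}}[\psi]=\int\mathcal{Q}_{g,V,y}\psi\,d\omega$ defines a tempered distribution); (ii) there exists $C>0$ such that $|\mathcal{F}^{-1}\{\mathcal{I}_{\mathcal{Q}_{g,V,y}}\}[\psi]|\le C\|\psi\|_{\Xi^k}$ for every $\psi\in\mathscr{S}(\mathbb{R}^d)$. Then $\mathcal{F}^{-1}\{\mathcal{I}_{\mathcal{Q}_{g,V,y}}\}$ extends uniquely to a continuous linear functional on $\Xi^k(\mathbb{R}^d;\mathbb{C})$,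 and its restriction to $\mathcal{A}_V(\mathbb{R}^d)$ equals the Tweedie functional $\mathcal{T}_{g,V,y}$. Equivalently, for every $f\in\mathcal{A}_V(\mathbb{R}^d)$ and every sequence $(f_n)\subset\mathscr{S}(\mathbb{R}^d)$ with $\|f_n-f\|_{\Xi^k}\to 0$, \[ \mathcal{T}_{g,V,y}[f]=\lim_{n\to\infty}\mathcal{F}^{-1}\{\mathcal{I}_{\mathcal{Q}_{g,V,y}}\}[f_n], \] and the limit does not depend on the approximating sequence.
   Context: Fourier conventions: $\widetilde\psi(\omega)=\int e^{i\omega^\top x}\psi(x)\,dx$ and $\psi^\sharp(x)=(2\pi)^{-d}\int e^{-i\omega^\top x}\psi(\omega)\,d\omega$; $\varphi_V(\omega)=\mathbb{E}[e^{i\omega^\top V}]$. $C_0^k(\mathbb{R}^d;\mathbb{C})$ is the space of $C^k$ functions all of whose partial derivatives of order $\le k$ vanish at infinity; $\Xi^k=C_0^k\cap L^1$ with norm $\|\psi\|_{\Xi^k}=\max_{|\alpha|\le k}\|\partial^\alpha\psi\|_\infty+\|\psi\|_1$. $\mathscr{S}(\mathbb{R}^d)$ is the Schwartz space; a tempered distribution is a continuous linear functional on it, and for a tempered distribution $T$, $\mathcal{F}^{-1}\{T\}[\psi]=T[\psi^\sharp]$. $\mathcal{M}(\mathbb{R}^d)$ is the space of finite signed Radon measures with total variation norm; $\mathcal{A}_V(\mathbb{R}^d)=\{f_V*\mu:\mu\in\mathcal{M}(\mathbb{R}^d)\}$ with norm $\|f_V*\mu\|_{\mathcal{A}_V}=\|\mu\|_{TV}$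 (the representing $\mu$ is unique). The Tweedie functional $\mathcal{T}_{g,V,y}$ is the unique continuous linear functional on $\mathcal{A}_V$ with $\mathcal{T}_{g,V,y}[f_V*\mu]=\int\lambda_{g,V,y}\,d\mu$ for all $\mu\in\mathcal{M}(\mathbb{R}^d)$. *)

theory Defs
  imports "HOL-Analysis.Analysis" "HOL-Probability.Probability"
begin

fun pds :: "'a::euclidean_space list \<Rightarrow> ('a \<Rightarrow> 'b::real_normed_vector) \<Rightarrow> 'a \<Rightarrow> 'b" where
  "pds [] f = f"
| "pds (b # bs) f = (\<lambda>x. frechet_derivative (pds bs f) (at x) b)"

definition multi_idx :: "nat \<Rightarrow> 'a::euclidean_space list set" where
  "multi_idx k = {bs. set bs \<subseteq> Basis \<and> length bs \<le> k}"

definition Ck :: "nat \<Rightarrow> ('a::euclidean_space \<Rightarrow> 'b::real_normed_vector) \<Rightarrow> bool" where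
  "Ck k f \<longleftrightarrow>
     (\<forall>bs. set bs \<subseteq> Basis \<and> length bs < k \<longrightarrow> (\<forall>x. pds bs f differentiable at x)) \<and>
     (\<forall>bs\<in>multi_idx k. continuous_on UNIV (pds bs f))"

definition C0k :: "nat \<Rightarrow> ('a::euclidean_space \<Rightarrow> 'b::real_normed_vector) \<Rightarrow> bool" where
  "C0k k f \<longleftrightarrow> Ck k f \<and> (\<forall>bs\<in>multi_idx k. (pds bs f \<longlongrightarrow> 0) at_infinity)"

definition Xi :: "nat \<Rightarrow> ('a::euclidean_space \<Rightarrow> complex) set" where
  "Xi k = {f. C0k k f \<and> integrable lborel f}"

definition xi_norm :: "nat \<Rightarrow> ('a::euclidean_space \<Rightarrow> complex) \<Rightarrow> real" where
  "xi_norm k f = (SUP bs\<in>multi_idx k. SUP x. norm (pds bs f x)) + (\<integral>x. norm (f x) \<partial>lborel)"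

definition schwartz :: "('a::euclidean_space \<Rightarrow> complex) \<Rightarrow> bool" where
  "schwartz f \<longleftrightarrow> (\<forall>k. Ck k f) \<and>
     (\<forall>bs (N::nat). set bs \<subseteq> Basis \<longrightarrow>
        bounded (range (\<lambda>x. (1 + norm x) ^ N *\<^sub>R pds bs f x)))"

definition ft :: "('a::euclidean_space \<Rightarrow> complex) \<Rightarrow> 'a \<Rightarrow> complex" where
  "ft f \<omega> = (\<integral>x. cis (\<omega> \<bullet> x) * f x \<partial>lborel)"

definition ift :: "('a::euclidean_space \<Rightarrow> complex) \<Rightarrow> 'a \<Rightarrow> complex" where
  "ift f x = complex_of_real (1 / (2 * pi) ^ DIM('a)) * (\<integral>\<omega>. cis (- (\<omega> \<bullet> x)) * f \<omega> \<partial>lborel)"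

definition char_fn :: "'s measure \<Rightarrow> ('s \<Rightarrow> 'a::euclidean_space) \<Rightarrow> 'a \<Rightarrow> complex" where
  "char_fn M V \<omega> = (\<integral>s. cis (\<omega> \<bullet> V s) \<partial>M)"

text \<open>F^{-1}{I_Q}[psi] = I_Q[psi^sharp] = \<integral> Q(omega) psi^sharp(omega) d omega.\<close>
definition inv_ft_reg_distr :: "('a::euclidean_space \<Rightarrow> complex) \<Rightarrow> ('a \<Rightarrow> complex) \<Rightarrow> complex" where
  "inv_ft_reg_distr Q \<psi> = (\<integral>\<omega>. Q \<omega> * ift \<psi> \<omega> \<partial>lborel)"

text \<open>A finite signed Borel (= Radon on R^d) measure mu is represented as mu1 - mu2 with
  mu1, mu2 finite Borel measures.\<close>
definition fin_borel :: "'a::euclidean_space measure \<Rightarrow> bool" where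
  "fin_borel \<mu> \<longleftrightarrow> finite_measure \<mu> \<and> sets \<mu> = sets borel"

definition conv_meas :: "('a::euclidean_space \<Rightarrow> real) \<Rightarrow> 'a measure \<Rightarrow> 'a measure \<Rightarrow> 'a \<Rightarrow> real" where
  "conv_meas fV \<mu>1 \<mu>2 x = (\<integral>z. fV (x - z) \<partial>\<mu>1) - (\<integral>z. fV (x - z) \<partial>\<mu>2)"

end

theory Submission
  imports Defs
begin

text \<open>
  Schwartz functions are dense in \<open>\<Xi>\<^sup>k\<close>: truncate \<open>f\<close> to a ball, then convolve with a Gaussian \<open>\<gamma>\<^sub>s\<close>
  of width \<open>s\<close>. In this order all derivatives fall on \<open>\<gamma>\<^sub>s\<close> and no product rule is needed. So there is
  exactly one bounded extension \<open>L\<close>. As the Fourier transform of \<open>\<gamma>\<^sub>s\<close> decays faster than \<open>Q\<close> grows,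
  removing the truncation is harmless for fixed \<open>s\<close>, and \<open>L (\<gamma>\<^sub>s * f)\<close> is still the integral of \<open>Q\<close>
  against the inverse transform of \<open>\<gamma>\<^sub>s * f\<close>. For \<open>f = f\<^sub>V * \<mu>\<close> the factor \<open>\<phi>\<^sub>V\<close> in that transform cancels
  the denominator of \<open>Q\<close>, and Fubini turns the integral into \<open>\<integral> (\<gamma>\<^sub>s * \<lambda>) d\<mu>\<close>. Now let \<open>s\<close> tend to 0.
\<close>

section \<open>Iterated partial derivatives\<close>

lemma multi_idx_Nil [simp]: "[] \<in> multi_idx k"
  by (simp add: multi_idx_def)

lemma multi_idx_0 [simp]: "multi_idx 0 = {[]}"
  by (auto simp: multi_idx_def)

lemma finite_multi_idx [simp]: "finite (multi_idx k :: 'a::euclidean_space list set)"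
  using finite_lists_length_le[of "Basis :: 'a set" k] by (simp add: multi_idx_def)

lemma Ck_has_derivative:
  assumes "Ck k f" "set bs \<subseteq> Basis" "length bs < k"
  shows "(pds bs f has_derivative frechet_derivative (pds bs f) (at x)) (at x)"
  using assms by (simp add: Ck_def frechet_derivative_works)

lemma Ck_continuous_pds:
  assumes "Ck k f" "bs \<in> multi_idx k"
  shows "continuous_on UNIV (pds bs f)"
  using assms by (simp add: Ck_def)

lemma pds_append: "pds (bs @ cs) f = pds bs (pds cs f)"
  by (induction bs) auto

lemma Ck_pds:
  assumes "Ck m f" "set cs \<subseteq> Basis" "length cs + k \<le> m"
  shows "Ck k (pds cs f)"
  using assms by (auto simp: Ck_def multi_idx_def simp flip: pds_append)

lemma pds_eqI:
  assumes "G [] = f"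
    and derivative: "\<And>bs x. \<lbrakk>set bs \<subseteq> Basis; length bs < k\<rbrakk> \<Longrightarrow> (G bs has_derivative G' bs x) (at x)"
    and G': "\<And>bs b x. \<lbrakk>set bs \<subseteq> Basis; length bs < k; b \<in> Basis\<rbrakk> \<Longrightarrow> G' bs x b = G (b # bs) x"
    and "bs \<in> multi_idx k"
  shows "pds bs f = G bs"
  using assms(4)
proof (induction bs)
  case Nil
  then show ?case
    using assms(1) by simp
next
  case (Cons b bs)
  then have bs: "set bs \<subseteq> Basis" "length bs < k" "b \<in> Basis" and "pds bs f = G bs"
    by (auto simp: multi_idx_def)
  then show ?case
    using frechet_derivative_at[OF derivative[OF bs(1,2)]] G'[OF bs] by auto
qed

lemma CkI:
  assumes "G [] = f"
    and derivative: "\<And>bs x. \<lbrakk>set bs \<subseteq> Basis; length bs < k\<rbrakk> \<Longrightarrow> (G bs has_derivative G' bs x) (at x)"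
    and "\<And>bs b x. \<lbrakk>set bs \<subseteq> Basis; length bs < k; b \<in> Basis\<rbrakk> \<Longrightarrow> G' bs x b = G (b # bs) x"
    and cont: "\<And>bs. bs \<in> multi_idx k \<Longrightarrow> continuous_on UNIV (G bs)"
  shows "Ck k f"
proof -
  have pds: "pds bs f = G bs" if "bs \<in> multi_idx k" for bs
    using assms(1-3) that by (rule pds_eqI)
  then have "pds bs f differentiable at x" if "set bs \<subseteq> Basis" "length bs < k" for bs x
    using derivative[OF that] that by (auto simp: differentiable_def multi_idx_def)
  then show ?thesis
    using pds cont by (simp add: Ck_def)
qed

lemma
  assumes A: "bounded_linear A" and f: "Ck k f"
  shows pds_bounded_linear: "bs \<in> multi_idx k \<Longrightarrow> pds bs (\<lambda>x. A (f x)) = (\<lambda>x. A (pds bs f x))"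
    and Ck_bounded_linear: "Ck k (\<lambda>x. A (f x))"
proof -
  let ?G = "\<lambda>bs x. A (pds bs f x)" and ?G' = "\<lambda>bs x h. A (frechet_derivative (pds bs f) (at x) h)"
  have derivative: "(?G bs has_derivative ?G' bs x) (at x)" if "set bs \<subseteq> Basis" "length bs < k" for bs x
    using Ck_has_derivative[OF f that] by (rule bounded_linear.has_derivative[OF A])
  show "bs \<in> multi_idx k \<Longrightarrow> pds bs (\<lambda>x. A (f x)) = (\<lambda>x. A (pds bs f x))"
    by (rule pds_eqI[where G = ?G and G' = ?G']) (auto intro: derivative)
  have "continuous_on UNIV (?G bs)" if "bs \<in> multi_idx k" for bs
    by (rule bounded_linear.continuous_on[OF A Ck_continuous_pds[OF f that]])
  then show "Ck k (\<lambda>x. A (f x))"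
    by (intro CkI[where G = ?G and G' = ?G']) (auto intro: derivative)
qed

lemma
  assumes f: "Ck k f" and g: "Ck k g"
  shows pds_add: "bs \<in> multi_idx k \<Longrightarrow> pds bs (\<lambda>x. f x + g x) = (\<lambda>x. pds bs f x + pds bs g x)"
    and Ck_add: "Ck k (\<lambda>x. f x + g x)"
proof -
  let ?G = "\<lambda>bs x. pds bs f x + pds bs g x"
    and ?G' = "\<lambda>bs x h. frechet_derivative (pds bs f) (at x) h + frechet_derivative (pds bs g) (at x) h"
  have derivative: "(?G bs has_derivative ?G' bs x) (at x)" if "set bs \<subseteq> Basis" "length bs < k" for bs x
    using that by (intro has_derivative_add Ck_has_derivative[OF f] Ck_has_derivative[OF g])
  show "bs \<in> multi_idx k \<Longrightarrow> pds bs (\<lambda>x. f x + g x) = (\<lambda>x. pds bs f x + pds bs g x)"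
    by (rule pds_eqI[where G = ?G and G' = ?G']) (auto intro: derivative)
  have "continuous_on UNIV (?G bs)" if "bs \<in> multi_idx k" for bs
    using that by (intro continuous_intros Ck_continuous_pds[OF f] Ck_continuous_pds[OF g])
  then show "Ck k (\<lambda>x. f x + g x)"
    by (intro CkI[where G = ?G and G' = ?G']) (auto intro: derivative)
qed

lemma
  fixes f g :: "'a::euclidean_space \<Rightarrow> 'b::real_normed_algebra"
  assumes f: "Ck k f" and g: "Ck k g"
  shows pds_lincomb: "bs \<in> multi_idx k \<Longrightarrow>
      pds bs (\<lambda>x. a * f x + b * g x) = (\<lambda>x. a * pds bs f x + b * pds bs g x)"
    and Ck_lincomb: "Ck k (\<lambda>x. a * f x + b * g x)"
proof -
  have mult_linear: "bounded_linear ((*) c)" for c :: 'b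
    by (rule bounded_linear_mult_right)
  have Ck_mult: "Ck k (\<lambda>x. a * f x)" "Ck k (\<lambda>x. b * g x)"
    by (intro Ck_bounded_linear[OF mult_linear] f g)+
  show "bs \<in> multi_idx k \<Longrightarrow> pds bs (\<lambda>x. a * f x + b * g x) = (\<lambda>x. a * pds bs f x + b * pds bs g x)"
    by (simp add: pds_add[OF Ck_mult] pds_bounded_linear[OF mult_linear f] pds_bounded_linear[OF mult_linear g])
  show "Ck k (\<lambda>x. a * f x + b * g x)"
    by (rule Ck_add[OF Ck_mult])
qed

section \<open>Functions vanishing at infinity\<close>

lemma C0k_imp_Ck: "C0k k f \<Longrightarrow> Ck k f"
  by (simp add: C0k_def)

lemma C0k_0_iff: "C0k 0 f \<longleftrightarrow> continuous_on UNIV f \<and> (f \<longlongrightarrow> 0) at_infinity"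
  by (simp add: C0k_def Ck_def)

lemma C0k_iff: "C0k k f \<longleftrightarrow> Ck k f \<and> (\<forall>bs\<in>multi_idx k. C0k 0 (pds bs f))"
  by (auto simp: C0k_def[of k] C0k_0_iff Ck_continuous_pds)

lemma C0k_pds:
  assumes "C0k m f" "set cs \<subseteq> Basis" "length cs + k \<le> m"
  shows "C0k k (pds cs f)"
  using assms Ck_pds[of m f cs k] by (auto simp: C0k_def multi_idx_def simp flip: pds_append)

lemma C0k_imp_C0k_0: "C0k k f \<Longrightarrow> C0k 0 f"
  using C0k_iff[of k f] multi_idx_Nil[of k] by fastforce

lemma C0k_0_borel_measurable: "C0k 0 f \<Longrightarrow> f \<in> borel_measurable borel"
  by (auto simp: C0k_0_iff intro: borel_measurable_continuous_onI)

lemma C0k_0_bounded: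
  fixes f :: "'a::euclidean_space \<Rightarrow> 'b::real_normed_vector"
  assumes "C0k 0 f"
  obtains B where "\<And>x. norm (f x) \<le> B"
proof -
  have "\<forall>\<^sub>F x in at_infinity. norm (f x) < 1"
    using assms tendstoD[of f 0 at_infinity 1] by (simp add: C0k_0_iff)
  then obtain R where outside_ball: "\<And>x. norm x \<ge> R \<Longrightarrow> norm (f x) < 1"
    by (auto simp: eventually_at_infinity)
  have "compact (f ` cball 0 R)"
    using assms by (intro compact_continuous_image) (auto simp: C0k_0_iff intro: continuous_on_subset)
  then obtain B where inside_ball: "\<And>x. norm x \<le> R \<Longrightarrow> norm (f x) \<le> B"
    by (metis bounded_iff compact_imp_bounded imageI mem_cball_0)
  have "norm (f x) \<le> max 1 B" for x
    using outside_ball[of x] inside_ball[of x] by (cases "norm x \<le> R") auto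
  then show thesis
    by (rule that)
qed

lemma C0k_0_uniformly_continuous:
  fixes f :: "'a::euclidean_space \<Rightarrow> 'b::real_normed_vector"
  assumes f: "C0k 0 f"
  shows "uniformly_continuous_on UNIV f"
  unfolding uniformly_continuous_on_def
proof (intro allI impI)
  fix e :: real assume "e > 0"
  then have "\<forall>\<^sub>F x in at_infinity. norm (f x) < e / 2"
    using f tendstoD[of f 0 at_infinity "e / 2"] by (simp add: C0k_0_iff)
  then obtain R where small_outside: "\<And>x. norm x \<ge> R \<Longrightarrow> norm (f x) < e / 2"
    by (auto simp: eventually_at_infinity)
  have "uniformly_continuous_on (cball 0 (R + 1)) f"
    using f by (intro compact_uniformly_continuous) (auto simp: C0k_0_iff intro: continuous_on_subset)
  then obtain d where close_inside: "d > 0"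
    "\<And>x z. norm x \<le> R + 1 \<Longrightarrow> norm z \<le> R + 1 \<Longrightarrow> dist z x < d \<Longrightarrow> dist (f z) (f x) < e"
    using \<open>e > 0\<close> unfolding uniformly_continuous_on_def by (metis mem_cball_0)
  have "dist (f z) (f x) < e" if zx: "dist z x < min d 1" for x z
  proof (cases "norm x \<le> R + 1 \<and> norm z \<le> R + 1")
    case True
    then show ?thesis
      using close_inside(2) zx by simp
  next
    case False
    have "norm x \<le> norm z + dist z x" "norm z \<le> norm x + dist z x"
      by norm+
    then have "norm x \<ge> R" "norm z \<ge> R"
      using False zx by auto
    then have "norm (f x) < e / 2" "norm (f z) < e / 2"
      using small_outside by blast+
    then show ?thesis
      using norm_triangle_ineq4[of "f z" "f x"] by (simp add: dist_norm)
  qed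
  then show "\<exists>d>0. \<forall>x\<in>UNIV. \<forall>z\<in>UNIV. dist z x < d \<longrightarrow> dist (f z) (f x) < e"
    using close_inside(1) by (intro exI[of _ "min d 1"]) auto
qed

lemma C0k_bounded_linear:
  assumes A: "bounded_linear A" and f: "C0k k f"
  shows "C0k k (\<lambda>x. A (f x))"
proof -
  note f_Ck = C0k_imp_Ck[OF f]
  have "(pds bs (\<lambda>x. A (f x)) \<longlongrightarrow> 0) at_infinity" if "bs \<in> multi_idx k" for bs
    unfolding pds_bounded_linear[OF A f_Ck that]
    using f that by (intro bounded_linear.tendsto_zero[OF A]) (simp add: C0k_def)
  then show ?thesis
    using Ck_bounded_linear[OF A f_Ck] by (simp add: C0k_def)
qed

lemma C0k_lincomb:
  fixes f g :: "'a::euclidean_space \<Rightarrow> 'b::real_normed_algebra"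
  assumes f: "C0k k f" and g: "C0k k g"
  shows "C0k k (\<lambda>x. a * f x + b * g x)"
proof -
  note Ck = C0k_imp_Ck[OF f] C0k_imp_Ck[OF g]
  have "(pds bs (\<lambda>x. a * f x + b * g x) \<longlongrightarrow> 0) at_infinity" if "bs \<in> multi_idx k" for bs
    unfolding pds_lincomb[OF Ck that]
    using f g that by (intro tendsto_add_zero tendsto_mult_right_zero) (auto simp: C0k_def)
  then show ?thesis
    using Ck_lincomb[OF Ck] by (simp add: C0k_def)
qed

section \<open>The norm of \<open>\<Xi>\<^sup>k\<close>\<close>

definition Ck_norm :: "nat \<Rightarrow> ('a::euclidean_space \<Rightarrow> 'b::real_normed_vector) \<Rightarrow> real" where
  "Ck_norm k f = (SUP bs\<in>multi_idx k. SUP x. norm (pds bs f x))"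

lemma xi_norm_eq: "xi_norm k f = Ck_norm k f + (\<integral>x. norm (f x) \<partial>lborel)"
  by (simp add: xi_norm_def Ck_norm_def)

lemma Ck_norm_le:
  assumes "\<And>bs x. bs \<in> multi_idx k \<Longrightarrow> norm (pds bs f x) \<le> B"
  shows "Ck_norm k f \<le> B"
  unfolding Ck_norm_def using assms multi_idx_Nil by (intro cSUP_least) blast+

lemma norm_pds_le_Ck_norm:
  fixes f :: "'a::euclidean_space \<Rightarrow> 'b::real_normed_vector"
  assumes "C0k k f" "bs \<in> multi_idx k"
  shows "norm (pds bs f x) \<le> Ck_norm k f"
proof -
  have "C0k 0 (pds bs f)"
    using assms by (simp add: C0k_iff[of k])
  then obtain B where "\<And>x. norm (pds bs f x) \<le> B"
    using C0k_0_bounded by blast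
  then have "norm (pds bs f x) \<le> (SUP x. norm (pds bs f x))"
    by (intro cSUP_upper) (auto simp: bdd_above_def)
  also have "\<dots> \<le> Ck_norm k f"
    unfolding Ck_norm_def using assms(2) by (intro cSUP_upper) (auto intro!: bdd_above_finite)
  finally show ?thesis .
qed

lemma Ck_norm_nonneg: "C0k k f \<Longrightarrow> 0 \<le> Ck_norm k f"
  by (rule order_trans[OF norm_ge_zero norm_pds_le_Ck_norm[OF _ multi_idx_Nil]])

lemma Xi_imp_C0k: "f \<in> Xi k \<Longrightarrow> C0k k f"
  by (simp add: Xi_def)

lemma Xi_integrable: "f \<in> Xi k \<Longrightarrow> integrable lborel f"
  by (simp add: Xi_def)

lemma
  assumes f: "f \<in> Xi k" and g: "g \<in> Xi k"
  shows Xi_lincomb: "(\<lambda>x. a * f x + b * g x) \<in> Xi k"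
    and xi_norm_lincomb_le: "xi_norm k (\<lambda>x. a * f x + b * g x) \<le>
      norm a * xi_norm k f + norm b * xi_norm k g"
proof -
  note f = Xi_imp_C0k[OF f] Xi_integrable[OF f] and g = Xi_imp_C0k[OF g] Xi_integrable[OF g]
  show "(\<lambda>x. a * f x + b * g x) \<in> Xi k"
    using C0k_lincomb[OF f(1) g(1)] f(2) g(2) by (simp add: Xi_def)
  have "norm (pds bs (\<lambda>x. a * f x + b * g x) x) \<le> norm a * Ck_norm k f + norm b * Ck_norm k g"
    if bs: "bs \<in> multi_idx k" for bs x
  proof -
    have "pds bs (\<lambda>x. a * f x + b * g x) x = a * pds bs f x + b * pds bs g x"
      using pds_lincomb[OF C0k_imp_Ck[OF f(1)] C0k_imp_Ck[OF g(1)] bs] by simp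
    also have "norm \<dots> \<le> norm a * norm (pds bs f x) + norm b * norm (pds bs g x)"
      by (metis norm_mult norm_triangle_ineq)
    also have "\<dots> \<le> norm a * Ck_norm k f + norm b * Ck_norm k g"
      using f(1) g(1) bs by (intro add_mono mult_left_mono norm_pds_le_Ck_norm) auto
    finally show ?thesis .
  qed
  moreover have "(\<integral>x. norm (a * f x + b * g x) \<partial>lborel) \<le>
      (\<integral>x. norm a * norm (f x) + norm b * norm (g x) \<partial>lborel)"
    using f(2) g(2) by (intro integral_mono) (auto simp flip: norm_mult intro: norm_triangle_ineq)
  ultimately show "xi_norm k (\<lambda>x. a * f x + b * g x) \<le> norm a * xi_norm k f + norm b * xi_norm k g"
    using f(2) g(2) Ck_norm_le[of k "\<lambda>x. a * f x + b * g x" "norm a * Ck_norm k f + norm b * Ck_norm k g"]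
    by (simp add: xi_norm_eq distrib_left)
qed

section \<open>Rapidly decreasing functions\<close>

definition rapidly_decreasing :: "('a::real_normed_vector \<Rightarrow> 'b::real_normed_vector) \<Rightarrow> bool" where
  "rapidly_decreasing f \<longleftrightarrow> (\<forall>N. \<exists>B. \<forall>x. (1 + norm x) ^ N * norm (f x) \<le> B)"

lemma rapidly_decreasingE:
  assumes "rapidly_decreasing f"
  obtains B where "\<And>x. (1 + norm x) ^ N * norm (f x) \<le> B"
  using assms by (auto simp: rapidly_decreasing_def)

lemma rapidly_decreasing_tendsto_0:
  fixes f :: "'a::real_normed_vector \<Rightarrow> 'b::real_normed_vector"
  assumes "rapidly_decreasing f"
  shows "(f \<longlongrightarrow> 0) at_infinity"
proof -
  obtain B where "\<And>x. (1 + norm x) ^ 1 * norm (f x) \<le> B"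
    using assms by (rule rapidly_decreasingE) blast
  then have "norm (f x) \<le> B * inverse (1 + norm x)" for x
    by (simp add: field_simps add_pos_nonneg)
  moreover have "((\<lambda>x :: 'a. B * inverse (1 + norm x)) \<longlongrightarrow> B * 0) at_infinity"
    by (intro tendsto_intros tendsto_inverse_0_at_top filterlim_norm_at_top
        filterlim_tendsto_add_at_top[OF tendsto_const])
  ultimately show ?thesis
    by (intro Lim_null_comparison[of f "\<lambda>x. B * inverse (1 + norm x)"]) auto
qed

lemma rapidly_decreasing_bounded_linear:
  assumes "bounded_linear A" "rapidly_decreasing f"
  shows "rapidly_decreasing (\<lambda>x. A (f x))"
  unfolding rapidly_decreasing_def
proof
  fix N
  obtain K where A_bound: "K \<ge> 0" "\<And>v. norm (A v) \<le> norm v * K"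
    using bounded_linear.nonneg_bounded[OF assms(1)] by blast
  obtain B where f_bound: "\<And>x. (1 + norm x) ^ N * norm (f x) \<le> B"
    using assms(2) by (rule rapidly_decreasingE) blast
  have "(1 + norm x) ^ N * norm (A (f x)) \<le> (1 + norm x) ^ N * (norm (f x) * K)" for x
    using A_bound by (intro mult_left_mono) auto
  also have "\<dots> x \<le> B * K" for x
    using mult_right_mono[OF f_bound A_bound(1)] by (simp add: mult.assoc)
  finally show "\<exists>B. \<forall>x. (1 + norm x) ^ N * norm (A (f x)) \<le> B"
    by blast
qed

lemma rapidly_decreasing_add:
  assumes "rapidly_decreasing f" "rapidly_decreasing g"
  shows "rapidly_decreasing (\<lambda>x. f x + g x)"
  unfolding rapidly_decreasing_def
proof
  fix N
  obtain A where f_bound: "\<And>x. (1 + norm x) ^ N * norm (f x) \<le> A"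
    using assms(1) by (rule rapidly_decreasingE) blast
  obtain B where g_bound: "\<And>x. (1 + norm x) ^ N * norm (g x) \<le> B"
    using assms(2) by (rule rapidly_decreasingE) blast
  have "(1 + norm x) ^ N * norm (f x + g x) \<le> (1 + norm x) ^ N * (norm (f x) + norm (g x))" for x
    by (intro mult_left_mono norm_triangle_ineq) simp
  also have "\<dots> x \<le> A + B" for x
    using add_mono[OF f_bound g_bound] by (simp add: distrib_left)
  finally show "\<exists>B. \<forall>x. (1 + norm x) ^ N * norm (f x + g x) \<le> B"
    by blast
qed

lemma rapidly_decreasing_polynomial_scaleR:
  fixes f :: "'a::real_normed_vector \<Rightarrow> 'b::real_normed_vector"
  assumes "real_polynomial_function p" "rapidly_decreasing f"
  shows "rapidly_decreasing (\<lambda>x. p x *\<^sub>R f x)"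
  using assms
proof (induction p arbitrary: f)
  case (linear p)
  obtain K where p_bound: "K > 0" "\<And>x. \<bar>p x\<bar> \<le> norm x * K"
    using bounded_linear.pos_bounded[OF linear(1)] by auto
  have p_le: "\<bar>p x\<bar> \<le> (1 + norm x) * K" for x
    using p_bound(2)[of x] p_bound(1) by (simp add: distrib_right)
  show ?case
    unfolding rapidly_decreasing_def
  proof
    fix N
    obtain B where f_bound: "\<And>x. (1 + norm x) ^ Suc N * norm (f x) \<le> B"
      using linear(2) by (rule rapidly_decreasingE) blast
    have "(1 + norm x) ^ N * norm (p x *\<^sub>R f x) \<le> (1 + norm x) ^ N * ((1 + norm x) * K * norm (f x))" for x
      using p_le[of x] by (simp add: mult_left_mono mult_right_mono)
    also have "\<dots> x \<le> K * B" for x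
      using mult_left_mono[OF f_bound less_imp_le[OF p_bound(1)]] by (simp add: mult_ac)
    finally show "\<exists>B. \<forall>x. (1 + norm x) ^ N * norm (p x *\<^sub>R f x) \<le> B"
      by blast
  qed
next
  case (const c)
  then show ?case
    by (intro rapidly_decreasing_bounded_linear[OF bounded_linear_scaleR_right])
next
  case (add p q)
  then show ?case
    by (simp add: scaleR_left_distrib rapidly_decreasing_add)
next
  case (mult p q)
  then show ?case
    by (simp flip: scaleR_scaleR)
qed

lemma schwartz_iff:
  "schwartz f \<longleftrightarrow> (\<forall>k. Ck k f) \<and> (\<forall>bs. set bs \<subseteq> Basis \<longrightarrow> rapidly_decreasing (pds bs f))"
proof -
  have "bounded (range (\<lambda>x. (1 + norm x) ^ N *\<^sub>R pds bs f x)) \<longleftrightarrow>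
    (\<exists>B. \<forall>x. (1 + norm x) ^ N * norm (pds bs f x) \<le> B)" for bs N
    by (simp add: bounded_iff abs_of_nonneg)
  then show ?thesis
    by (auto simp: schwartz_def rapidly_decreasing_def)
qed

lemma schwartz_imp_Ck: "schwartz f \<Longrightarrow> Ck k f"
  by (simp add: schwartz_iff)

lemma schwartz_imp_C0k:
  assumes "schwartz f"
  shows "C0k k f"
  using assms by (auto simp: C0k_def schwartz_iff multi_idx_def intro: rapidly_decreasing_tendsto_0)

lemma schwartz_pds:
  assumes "schwartz f" "set cs \<subseteq> Basis"
  shows "schwartz (pds cs f)"
  using assms Ck_pds[of "length cs + k" f cs k for k] by (auto simp: schwartz_iff simp flip: pds_append)

lemma schwartz_lincomb:
  assumes f: "schwartz f" and g: "schwartz g"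
  shows "schwartz (\<lambda>x. a * f x + b * g x)"
proof -
  have "rapidly_decreasing (pds bs (\<lambda>x. a * f x + b * g x))" if bs: "set bs \<subseteq> Basis" for bs
  proof -
    have "bs \<in> multi_idx (length bs)"
      using bs by (simp add: multi_idx_def)
    note pds_lincomb[OF schwartz_imp_Ck[OF f] schwartz_imp_Ck[OF g] this, of a b]
    then show ?thesis
      using f g bs by (simp add: schwartz_iff rapidly_decreasing_add
          rapidly_decreasing_bounded_linear[OF bounded_linear_mult_right])
  qed
  then show ?thesis
    using f g by (simp add: schwartz_iff Ck_lincomb)
qed

section \<open>Integration and limits\<close>

lemma lborel_integrable_affine:
  fixes f :: "'a::euclidean_space \<Rightarrow> 'b::{banach, second_countable_topology}"
  assumes f: "integrable lborel f" and c_nonzero: "c \<noteq> 0"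
  shows "integrable lborel (\<lambda>x. f (t + c *\<^sub>R x))"
proof -
  have [measurable]: "f \<in> borel_measurable borel"
    using borel_measurable_integrable[OF f] by simp
  have "(\<integral>\<^sup>+ x. norm (f x) \<partial>lborel) = ennreal (\<bar>c\<bar> ^ DIM('a)) * (\<integral>\<^sup>+ x. norm (f (t + c *\<^sub>R x)) \<partial>lborel)"
    by (subst lborel_affine[OF c_nonzero, of t])
      (simp add: nn_integral_density nn_integral_distr nn_integral_cmult)
  then show ?thesis
    using f c_nonzero unfolding integrable_iff_bounded by (auto simp: ennreal_mult_less_top)
qed

lemma lborel_integrable_affine_iff:
  fixes f :: "'a::euclidean_space \<Rightarrow> 'b::{banach, second_countable_topology}"
  assumes "c \<noteq> 0"
  shows "integrable lborel (\<lambda>x. f (t + c *\<^sub>R x)) \<longleftrightarrow> integrable lborel f"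
proof
  show "integrable lborel f" if "integrable lborel (\<lambda>x. f (t + c *\<^sub>R x))"
    using lborel_integrable_affine[OF that, of "1 / c" "- (1 / c) *\<^sub>R t"] assms
    by (simp add: scaleR_diff_right)
qed (use lborel_integrable_affine assms in blast)

lemma lborel_integral_affine:
  fixes f :: "'a::euclidean_space \<Rightarrow> 'b::{banach, second_countable_topology}"
  assumes c_nonzero: "c \<noteq> 0"
  shows "(\<integral>x. f x \<partial>lborel) = \<bar>c\<bar> ^ DIM('a) *\<^sub>R (\<integral>x. f (t + c *\<^sub>R x) \<partial>lborel)"
proof (cases "integrable lborel f")
  case True
  then have [measurable]: "f \<in> borel_measurable borel"
    using borel_measurable_integrable by auto
  show ?thesis
    by (subst lborel_affine[OF c_nonzero, of t]) (simp add: integral_density integral_distr)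
next
  case False
  then show ?thesis
    using c_nonzero by (simp add: lborel_integrable_affine_iff not_integrable_integral_eq)
qed

lemma lborel_integral_reflect:
  fixes f :: "'a::euclidean_space \<Rightarrow> 'b::{banach, second_countable_topology}"
  shows "(\<integral>x. f (t - x) \<partial>lborel) = (\<integral>x. f x \<partial>lborel)"
  using lborel_integral_affine[of "- 1" f t] by simp

lemma lborel_integral_translate:
  fixes f :: "'a::euclidean_space \<Rightarrow> 'b::{banach, second_countable_topology}"
  shows "(\<integral>x. f (x - t) \<partial>lborel) = (\<integral>x. f x \<partial>lborel)"
  using lborel_integral_affine[of 1 f "- t"] by simp

lemma lborel_integrable_translate:
  fixes f :: "'a::euclidean_space \<Rightarrow> 'b::{banach, second_countable_topology}"
  assumes "integrable lborel f"
  shows "integrable lborel (\<lambda>x. f (x - t))"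
  using lborel_integrable_affine[OF assms, of 1 "- t"] by simp

lemma AE_lborel_uminus:
  assumes "AE x in lborel. P x"
  shows "AE x in (lborel :: 'a::euclidean_space measure). P (- x)"
proof (rule AE_distrD[where f = uminus and M' = borel])
  have distr: "distr lborel borel uminus = (lborel :: 'a measure)"
    using lborel_affine[of "- 1" "0 :: 'a"] by (simp add: density_1)
  show "AE x in distr lborel borel uminus. P (x :: 'a)"
    unfolding distr by (rule assms)
qed simp

lemma integrable_dominated:
  fixes f :: "'s \<Rightarrow> 'b::{banach, second_countable_topology}"
  assumes "integrable N g" "f \<in> borel_measurable N" "\<And>x. norm (f x) \<le> g x"
  shows "integrable N f"
  by (rule Bochner_Integration.integrable_bound[OF assms(1,2)])
    (auto intro: order_trans[OF assms(3) abs_ge_self])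

lemma integrable_mult_bounded:
  fixes w c :: "'s \<Rightarrow> 'b::{real_normed_algebra, banach, second_countable_topology}"
  assumes w: "integrable N w" and c_bounded: "c \<in> borel_measurable N" "\<And>x. norm (c x) \<le> B"
  shows "integrable N (\<lambda>x. w x * c x)"
proof (rule integrable_dominated)
  show "integrable N (\<lambda>x. norm (w x) * B)"
    using w by simp
  show "norm (w x * c x) \<le> norm (w x) * B" for x
    by (rule order_trans[OF norm_mult_ineq mult_left_mono[OF c_bounded(2)]]) simp
qed (use w c_bounded in simp)

lemma norm_integral_mult_bounded_le:
  fixes w c :: "'s \<Rightarrow> 'b::{real_normed_algebra, banach, second_countable_topology}"
  assumes w: "integrable N w" and c_bounded: "c \<in> borel_measurable N" "\<And>x. norm (c x) \<le> B"
  shows "norm (\<integral>x. w x * c x \<partial>N) \<le> (\<integral>x. norm (w x) \<partial>N) * B"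
proof -
  have "norm (\<integral>x. w x * c x \<partial>N) \<le> (\<integral>x. norm (w x * c x) \<partial>N)"
    by (rule integral_norm_bound)
  also have "\<dots> \<le> (\<integral>x. norm (w x) * B \<partial>N)"
    using w by (intro integral_mono integrable_norm integrable_mult_bounded[OF assms])
      (auto intro: order_trans[OF norm_mult_ineq mult_left_mono[OF c_bounded(2)]])
  finally show ?thesis
    by simp
qed

lemma tendsto_integral_mult_bounded:
  fixes w :: "'s \<Rightarrow> 'b::{real_normed_algebra, banach, second_countable_topology}"
  assumes w: "integrable N w" and F [measurable]: "\<And>n. F n \<in> borel_measurable N"
    and F_bound: "\<And>n x. norm (F n x) \<le> B" and lim: "\<And>x. (\<lambda>n. F n x) \<longlonglongrightarrow> G x"
  shows "(\<lambda>n. \<integral>x. w x * F n x \<partial>N) \<longlonglongrightarrow> (\<integral>x. w x * G x \<partial>N)"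
proof (rule integral_dominated_convergence)
  have [measurable]: "w \<in> borel_measurable N" "G \<in> borel_measurable N"
    using w borel_measurable_LIMSEQ_metric[OF F lim] by auto
  show "(\<lambda>x. w x * G x) \<in> borel_measurable N" "(\<lambda>x. w x * F n x) \<in> borel_measurable N" for n
    by measurable
  show "integrable N (\<lambda>x. norm (w x) * B)"
    using w by simp
  show "AE x in N. (\<lambda>n. w x * F n x) \<longlonglongrightarrow> w x * G x"
    by (intro AE_I2 tendsto_intros lim)
  show "AE x in N. norm (w x * F n x) \<le> norm (w x) * B" for n
    by (intro AE_I2 order_trans[OF norm_mult_ineq mult_left_mono[OF F_bound]]) simp
qed

lemma norm_difference_quotient_le:
  fixes f :: "'a::{real_normed_vector, perfect_space} \<Rightarrow> 'b::real_normed_vector"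
  assumes f': "\<And>x. (f has_derivative f' x) (at x)"
    and bound: "\<And>x h. norm (f' x h) \<le> K * norm h" and "u \<noteq> x"
  shows "norm ((f u - f x - f' x (u - x)) /\<^sub>R norm (u - x)) \<le> 2 * K"
proof -
  have "norm (f u - f x) \<le> K * norm (u - x)"
  proof (rule differentiable_bound[where S = UNIV])
    show "onorm (f' v) \<le> K" for v
      by (rule onorm_le) (rule bound)
  qed (use f' in auto)
  then have "norm (f u - f x - f' x (u - x)) \<le> 2 * K * norm (u - x)"
    using bound[of x "u - x"] norm_triangle_ineq4[of "f u - f x" "f' x (u - x)"] by simp
  then show ?thesis
    using \<open>u \<noteq> x\<close> by (simp add: divide_simps)
qed

lemma has_derivative_integral:
  fixes f :: "'a::{real_normed_vector, perfect_space} \<Rightarrow> 's \<Rightarrow> 'b::{banach, second_countable_topology}"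
  assumes f': "\<And>x z. ((\<lambda>x. f x z) has_derivative f' x z) (at x)"
    and dominated: "integrable N K" "\<And>x z h. norm (f' x z h) \<le> K z * norm h"
    and f_int: "\<And>x. integrable N (f x)" and f'_meas: "\<And>h. (\<lambda>z. f' x z h) \<in> borel_measurable N"
  shows "((\<lambda>x. \<integral>z. f x z \<partial>N) has_derivative (\<lambda>h. \<integral>z. f' x z h \<partial>N)) (at x)"
proof (rule has_derivativeI)
  have f'_lin: "linear (f' x z)" for x z
    by (rule has_derivative_linear[OF f'])
  have f'_int: "integrable N (\<lambda>z. f' x z h)" for h
    using integrable_mult_left[OF dominated(1)] f'_meas dominated(2) by (rule integrable_dominated)
  show "bounded_linear (\<lambda>h. \<integral>z. f' x z h \<partial>N)"
  proof (rule bounded_linear_intro)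
    fix h
    have "norm (\<integral>z. f' x z h \<partial>N) \<le> (\<integral>z. norm (f' x z h) \<partial>N)"
      by (rule integral_norm_bound)
    also have "\<dots> \<le> (\<integral>z. K z * norm h \<partial>N)"
      using dominated f'_int by (intro integral_mono) auto
    finally show "norm (\<integral>z. f' x z h \<partial>N) \<le> norm h * (\<integral>z. K z \<partial>N)"
      by (simp add: mult.commute)
  qed (use f'_int in \<open>simp_all add: linear_add[OF f'_lin] linear_scale[OF f'_lin]\<close>)
  define R where "R u z = (f u z - f x z - f' x z (u - x)) /\<^sub>R norm (u - x)" for u z
  have integral_R: "(\<integral>z. R u z \<partial>N) =
    ((\<integral>z. f u z \<partial>N) - (\<integral>z. f x z \<partial>N) - (\<integral>z. f' x z (u - x) \<partial>N)) /\<^sub>R norm (u - x)" for u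
    unfolding R_def using f_int f'_int by simp
  have "(\<lambda>n. \<integral>z. R (u n) z \<partial>N) \<longlonglongrightarrow> (\<integral>z. 0 \<partial>N)" if u: "\<forall>n. u n \<noteq> x" "u \<longlonglongrightarrow> x" for u
  proof (rule integral_dominated_convergence)
    show "R (u n) \<in> borel_measurable N" for n
      using borel_measurable_integrable[OF f_int] f'_meas unfolding R_def by measurable
    show "integrable N (\<lambda>z. 2 * K z)"
      using dominated(1) by simp
    show "AE z in N. norm (R (u n) z) \<le> 2 * K z" for n
      unfolding R_def using u(1) by (intro AE_I2 norm_difference_quotient_le f' dominated(2)) blast
    have "((\<lambda>v. R v z) \<longlongrightarrow> 0) (at x)" for z
      using f'[of z x] unfolding R_def by (simp add: has_derivative_at_within)
    then show "AE z in N. (\<lambda>n. R (u n) z) \<longlonglongrightarrow> 0"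
      using u by (auto simp: tendsto_at_iff_sequentially comp_def)
  qed simp
  then show "((\<lambda>u. ((\<integral>z. f u z \<partial>N) - (\<integral>z. f x z \<partial>N) - (\<integral>z. f' x z (u - x) \<partial>N)) /\<^sub>R
      norm (u - x)) \<longlongrightarrow> 0) (at x)"
    unfolding integral_R[symmetric] by (simp add: tendsto_at_iff_sequentially comp_def)
qed

lemma tendsto_at_infinity_sequentiallyI:
  fixes f :: "'a::real_normed_vector \<Rightarrow> 'b::metric_space"
  assumes "\<And>u. filterlim u at_infinity sequentially \<Longrightarrow> (\<lambda>n. f (u n)) \<longlonglongrightarrow> l"
  shows "(f \<longlongrightarrow> l) at_infinity"
proof (rule ccontr)
  assume "\<not> ?thesis"
  then obtain e where e: "e > 0" "\<not> eventually (\<lambda>x. dist (f x) l < e) at_infinity"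
    by (auto simp: tendsto_iff)
  then have "\<exists>x. real n \<le> norm x \<and> e \<le> dist (f x) l" for n
    unfolding eventually_at_infinity by (meson not_le)
  then obtain u where u: "\<And>n. real n \<le> norm (u n)" "\<And>n. e \<le> dist (f (u n)) l"
    by metis
  have "filterlim u at_infinity sequentially"
    using filterlim_real_sequentially u(1)
    by (intro filterlim_norm_at_top_imp_at_infinity) (auto intro: filterlim_at_top_mono)
  then have "\<forall>\<^sub>F n in sequentially. dist (f (u n)) l < e"
    using e(1) by (intro tendstoD assms)
  then show False
    using u(2) by (auto simp: eventually_sequentially not_less[symmetric])
qed

lemma one_plus_norm_power_le: "(1 + norm x) ^ m \<le> (1 + norm z) ^ m * (1 + norm (x - z)) ^ m"
  for x z :: "'v::real_normed_vector"
proof -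
  have "1 + norm x \<le> (1 + norm z) * (1 + norm (x - z))"
    using add_increasing2[OF mult_nonneg_nonneg norm_triangle_sub[of x z], of "norm z" "norm (x - z)"]
    by (simp add: algebra_simps)
  then show ?thesis
    unfolding power_mult_distrib[symmetric] by (intro power_mono) auto
qed

lemma linear_eq_sum_Basis:
  fixes L :: "'a::euclidean_space \<Rightarrow> 'b::real_vector"
  assumes "linear L"
  shows "L h = (\<Sum>b\<in>Basis. (h \<bullet> b) *\<^sub>R L b)"
proof -
  have "L h = L (\<Sum>b\<in>Basis. (h \<bullet> b) *\<^sub>R b)"
    by (simp only: euclidean_representation)
  then show ?thesis
    by (simp only: linear_sum[OF assms] linear_scale[OF assms])
qed

section \<open>Weighted convolutions\<close>

definition wconv :: "'a::euclidean_space measure \<Rightarrow> ('a \<Rightarrow> 'b) \<Rightarrow> ('a \<Rightarrow> 'b) \<Rightarrow>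
    'a \<Rightarrow> 'b::{real_normed_algebra, banach, second_countable_topology}" where
  "wconv N w F x = (\<integral>z. w z * F (x - z) \<partial>N)"

context
  fixes N :: "'a::euclidean_space measure"
    and w :: "'a \<Rightarrow> 'b::{real_normed_algebra, banach, second_countable_topology}"
  assumes sets_N: "sets N = sets borel" and w: "integrable N w"
begin

lemma wconv_integrand_measurable:
  assumes "F \<in> borel_measurable borel"
  shows "(\<lambda>z. F (x - z)) \<in> borel_measurable N"
  using assms by (simp add: measurable_cong_sets[OF sets_N refl])

lemma wconv_integrable:
  assumes "F \<in> borel_measurable borel" "\<And>x. norm (F x) \<le> B"
  shows "integrable N (\<lambda>z. w z * F (x - z))"
  using w wconv_integrand_measurable[OF assms(1)] assms(2) by (rule integrable_mult_bounded)

lemma norm_wconv_le: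
  assumes "F \<in> borel_measurable borel" "\<And>x. norm (F x) \<le> B"
  shows "norm (wconv N w F x) \<le> (\<integral>z. norm (w z) \<partial>N) * B"
  unfolding wconv_def
  using w wconv_integrand_measurable[OF assms(1)] assms(2) by (rule norm_integral_mult_bounded_le)

lemma C0k_0_wconv_LIMSEQ:
  assumes F: "C0k 0 F" and "\<And>z. (\<lambda>n. F (u n - z)) \<longlonglongrightarrow> G z"
  shows "(\<lambda>n. wconv N w F (u n)) \<longlonglongrightarrow> (\<integral>z. w z * G z \<partial>N)"
proof -
  obtain B where "\<And>x. norm (F x) \<le> B"
    using C0k_0_bounded[OF F] by blast
  then show ?thesis
    unfolding wconv_def using assms(2) wconv_integrand_measurable[OF C0k_0_borel_measurable[OF F]]
    by (intro tendsto_integral_mult_bounded[OF w]) auto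
qed

lemma C0k_0_wconv:
  assumes F: "C0k 0 F"
  shows "C0k 0 (wconv N w F)"
  unfolding C0k_0_iff
proof
  have "(\<lambda>n. wconv N w F (u n)) \<longlonglongrightarrow> wconv N w F x" if "u \<longlonglongrightarrow> x" for u x
    unfolding wconv_def[of N w F x]
  proof (rule C0k_0_wconv_LIMSEQ[OF F])
    show "(\<lambda>n. F (u n - z)) \<longlonglongrightarrow> F (x - z)" for z
      using F by (intro continuous_on_tendsto_compose[of UNIV F])
        (auto simp: C0k_0_iff intro!: tendsto_intros that)
  qed
  then show "continuous_on UNIV (wconv N w F)"
    by (auto simp: continuous_on_sequentially comp_def)
  show "(wconv N w F \<longlongrightarrow> 0) at_infinity"
  proof (rule tendsto_at_infinity_sequentiallyI)
    fix u :: "nat \<Rightarrow> 'a" assume u: "filterlim u at_infinity sequentially"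
    have "(\<lambda>n. F (u n - z)) \<longlonglongrightarrow> 0" for z
    proof (rule filterlim_compose[of F "nhds 0" at_infinity])
      show "filterlim (\<lambda>n. u n - z) at_infinity sequentially"
        using tendsto_add_filterlim_at_infinity[OF tendsto_const u, of "- z"] by simp
    qed (use F in \<open>simp add: C0k_0_iff\<close>)
    then show "(\<lambda>n. wconv N w F (u n)) \<longlonglongrightarrow> 0"
      using C0k_0_wconv_LIMSEQ[OF F, of u "\<lambda>_. 0"] by simp
  qed
qed

lemma has_derivative_wconv:
  assumes F: "C0k 1 F"
  shows "(wconv N w F has_derivative (\<lambda>h. wconv N w (\<lambda>u. frechet_derivative F (at u) h) x)) (at x)"
  unfolding wconv_def
proof (rule has_derivative_integral)
  let ?F' = "\<lambda>u. frechet_derivative F (at u)"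
  have F': "(F has_derivative ?F' u) (at u)" for u
    using F Ck_has_derivative[of 1 F "[]"] by (simp add: C0k_def)
  have F'_Basis: "?F' u h = (\<Sum>b\<in>Basis. (h \<bullet> b) *\<^sub>R ?F' u b)" for u h
    by (rule linear_eq_sum_Basis[OF has_derivative_linear[OF F']])
  have pds_Basis: "[b] \<in> multi_idx 1" if "b \<in> Basis" for b :: 'a
    using that by (simp add: multi_idx_def)
  have F'_bound: "norm (?F' u h) \<le> DIM('a) * Ck_norm 1 F * norm h" for u h
  proof -
    have "norm (?F' u h) \<le> (\<Sum>b\<in>(Basis :: 'a set). norm h * Ck_norm 1 F)"
      unfolding F'_Basis[of u h] using norm_pds_le_Ck_norm[OF F pds_Basis, of _ u]
      by (intro sum_norm_le) (auto intro!: mult_mono Basis_le_norm)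
    then show ?thesis
      by (simp add: mult_ac)
  qed
  have F'_meas: "(\<lambda>u. ?F' u h) \<in> borel_measurable borel" for h
  proof (subst F'_Basis, intro borel_measurable_sum borel_measurable_scaleR borel_measurable_const)
    show "(\<lambda>u. ?F' u b) \<in> borel_measurable borel" if "b \<in> Basis" for b
      using C0k_pds[OF F, of "[b]" 0] that by (intro C0k_0_borel_measurable) simp
  qed
  show "integrable N (\<lambda>z. norm (w z) * (DIM('a) * Ck_norm 1 F))"
    using w by simp
  show "((\<lambda>x. w z * F (x - z)) has_derivative (\<lambda>h. w z * ?F' (x - z) h)) (at x)" for x z
    by (rule has_derivative_mult_right[OF has_derivative_compose[OF _ F', where f = "\<lambda>x. x - z"], simplified])
      (auto intro!: derivative_eq_intros)
  show "norm (w z * ?F' (x - z) h) \<le> norm (w z) * (DIM('a) * Ck_norm 1 F) * norm h" for x z h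
    using F'_bound[of "x - z" h]
    by (auto simp: mult.assoc intro!: order_trans[OF norm_mult_ineq] mult_left_mono)
  obtain B where "\<And>x. norm (F x) \<le> B"
    using C0k_0_bounded[OF C0k_imp_C0k_0[OF F]] by blast
  then show "integrable N (\<lambda>z. w z * F (x - z))" for x
    by (intro wconv_integrable C0k_0_borel_measurable C0k_imp_C0k_0[OF F])
  show "(\<lambda>z. w z * ?F' (x - z) h) \<in> borel_measurable N" for h
    using w wconv_integrand_measurable[OF F'_meas] by auto
qed

lemma
  assumes F: "C0k k F"
  shows pds_wconv: "bs \<in> multi_idx k \<Longrightarrow> pds bs (wconv N w F) = wconv N w (pds bs F)"
    and C0k_wconv: "C0k k (wconv N w F)"
proof -
  let ?G = "\<lambda>bs. wconv N w (pds bs F)"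
    and ?G' = "\<lambda>bs x h. wconv N w (\<lambda>u. frechet_derivative (pds bs F) (at u) h) x"
  have derivative: "(?G bs has_derivative ?G' bs x) (at x)" if "set bs \<subseteq> Basis" "length bs < k" for bs x
    using that by (intro has_derivative_wconv C0k_pds[OF F]) auto
  show pds: "pds bs (wconv N w F) = wconv N w (pds bs F)" if "bs \<in> multi_idx k" for bs
    by (rule pds_eqI[where G = ?G and G' = ?G', OF _ derivative _ that]) auto
  have G_vanishing: "C0k 0 (?G bs)" if "bs \<in> multi_idx k" for bs
    using that by (intro C0k_0_wconv C0k_pds[OF F]) (auto simp: multi_idx_def)
  have "Ck k (wconv N w F)"
    by (rule CkI[where G = ?G and G' = ?G', OF _ derivative]) (use G_vanishing in \<open>auto simp: C0k_0_iff\<close>)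
  then show "C0k k (wconv N w F)"
    using G_vanishing pds by (simp add: C0k_iff[of k])
qed

lemma rapidly_decreasing_wconv:
  assumes F: "F \<in> borel_measurable borel" "rapidly_decreasing F"
    and moments: "\<And>m. integrable N (\<lambda>z. (1 + norm z) ^ m *\<^sub>R w z)"
  shows "rapidly_decreasing (wconv N w F)"
  unfolding rapidly_decreasing_def
proof
  fix m
  obtain B where F_bound: "\<And>x. (1 + norm x) ^ m * norm (F x) \<le> B"
    using F(2) by (rule rapidly_decreasingE) blast
  let ?W = "\<lambda>z. norm ((1 + norm z) ^ m *\<^sub>R w z)"
  have "(1 + norm x) ^ m * norm (wconv N w F x) \<le> (\<integral>z. ?W z * B \<partial>N)" for x
  proof -
    have weight: "(1 + norm x) ^ m * norm (w z * F (x - z)) \<le> ?W z * B" for z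
    proof -
      have "(1 + norm x) ^ m * norm (w z * F (x - z)) \<le>
          ((1 + norm z) ^ m * (1 + norm (x - z)) ^ m) * (norm (w z) * norm (F (x - z)))"
        by (intro mult_mono one_plus_norm_power_le norm_mult_ineq) auto
      also have "\<dots> = ?W z * ((1 + norm (x - z)) ^ m * norm (F (x - z)))"
        by (simp add: mult_ac)
      also have "\<dots> \<le> ?W z * B"
        by (intro mult_left_mono F_bound norm_ge_zero)
      finally show ?thesis .
    qed
    have "(1 + norm x) ^ m * norm (wconv N w F x) = norm (\<integral>z. (1 + norm x) ^ m *\<^sub>R (w z * F (x - z)) \<partial>N)"
      by (simp add: wconv_def)
    also have "\<dots> \<le> (\<integral>z. norm ((1 + norm x) ^ m *\<^sub>R (w z * F (x - z))) \<partial>N)"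
      by (rule integral_norm_bound)
    also have "\<dots> \<le> (\<integral>z. ?W z * B \<partial>N)"
    proof (rule integral_mono')
      show "integrable N (\<lambda>z. ?W z * B)"
        using moments by (intro integrable_mult_left integrable_norm)
      show "0 \<le> ?W z * B" for z
        by (rule order_trans[OF _ weight]) simp
    qed (use weight in \<open>auto simp: abs_of_nonneg\<close>)
    finally show ?thesis .
  qed
  then show "\<exists>B. \<forall>x. (1 + norm x) ^ m * norm (wconv N w F x) \<le> B"
    by blast
qed

end

lemma wconv_commute:
  fixes f g :: "'a::euclidean_space \<Rightarrow> 'b::{real_normed_field, banach, second_countable_topology}"
  shows "wconv lborel f g = wconv lborel g f"
proof
  fix x
  have "wconv lborel f g x = (\<integral>z. f (x - z) * g (x - (x - z)) \<partial>lborel)"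
    unfolding wconv_def by (rule lborel_integral_reflect[symmetric])
  then show "wconv lborel f g x = wconv lborel g f x"
    by (simp add: wconv_def mult.commute)
qed

context
  fixes N :: "'a::euclidean_space measure"
    and w F :: "'a \<Rightarrow> 'b::{real_normed_field, banach, second_countable_topology}"
  assumes sigma_finite_N: "sigma_finite_measure N" and sets_N [measurable_cong]: "sets N = sets borel"
    and w: "integrable N w" and F: "integrable lborel F"
begin

interpretation pair_sigma_finite N lborel
  by (intro pair_sigma_finite.intro sigma_finite_N sigma_finite_lborel)

lemma integrable_pair_wconv: "integrable (N \<Otimes>\<^sub>M lborel) (\<lambda>(z, x). w z * F (x - z))"
proof (rule Fubini_integrable)
  have [measurable]: "w \<in> borel_measurable borel" "F \<in> borel_measurable borel"
    using w F by (auto simp: measurable_cong_sets[OF sets_N refl] dest!: borel_measurable_integrable)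
  show "(\<lambda>(z, x). w z * F (x - z)) \<in> borel_measurable (N \<Otimes>\<^sub>M lborel)"
    by measurable
  have "(\<integral>x. norm (w z * F (x - z)) \<partial>lborel) = norm (w z) * (\<integral>x. norm (F x) \<partial>lborel)" for z
    using lborel_integral_translate[of "\<lambda>x. norm (F x)" z] by (simp add: norm_mult)
  then show "integrable N (\<lambda>z. \<integral>x. norm (case (z, x) of (z, x) \<Rightarrow> w z * F (x - z)) \<partial>lborel)"
    using w by simp
  show "AE z in N. integrable lborel (\<lambda>x. case (z, x) of (z, x) \<Rightarrow> w z * F (x - z))"
    using lborel_integrable_translate[OF F] by simp
qed

lemma integrable_wconv: "integrable lborel (wconv N w F)"
  using integrable_snd[OF integrable_pair_wconv] by (simp add: wconv_def[abs_def])

lemma integral_mult_wconv: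
  assumes [measurable]: "c \<in> borel_measurable borel" and "\<And>x. norm (c x) \<le> B"
  shows "(\<integral>x. c x * wconv N w F x \<partial>lborel) = (\<integral>z. w z * (\<integral>x. c x * F (x - z) \<partial>lborel) \<partial>N)"
proof -
  have "integrable (N \<Otimes>\<^sub>M lborel) (\<lambda>p. (case p of (z, x) \<Rightarrow> w z * F (x - z)) * c (snd p))"
    using assms by (intro integrable_mult_bounded[OF integrable_pair_wconv]) auto
  then have "integrable (N \<Otimes>\<^sub>M lborel) (\<lambda>(z, x). w z * (c x * F (x - z)))"
    by (simp add: case_prod_beta' mult_ac)
  then have "(\<integral>x. (\<integral>z. w z * (c x * F (x - z)) \<partial>N) \<partial>lborel) =
      (\<integral>z. (\<integral>x. w z * (c x * F (x - z)) \<partial>lborel) \<partial>N)"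
    by (rule Fubini_integral)
  moreover have "c x * wconv N w F x = (\<integral>z. w z * (c x * F (x - z)) \<partial>N)" for x
    unfolding wconv_def integral_mult_right_zero[symmetric] by (simp add: mult_ac)
  ultimately show ?thesis
    by simp
qed

lemma integral_norm_wconv_le:
  "(\<integral>x. norm (wconv N w F x) \<partial>lborel) \<le> (\<integral>z. norm (w z) \<partial>N) * (\<integral>x. norm (F x) \<partial>lborel)"
proof -
  have pair_int: "integrable (N \<Otimes>\<^sub>M lborel) (\<lambda>(z, x). norm (w z * F (x - z)))"
    using integrable_norm[OF integrable_pair_wconv] by (simp add: case_prod_beta')
  have "(\<integral>x. norm (wconv N w F x) \<partial>lborel) \<le> (\<integral>x. (\<integral>z. norm (w z * F (x - z)) \<partial>N) \<partial>lborel)"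
    using integrable_snd[OF pair_int]
    by (intro integral_mono integrable_norm integrable_wconv) (auto simp: wconv_def)
  also have "\<dots> = (\<integral>z. (\<integral>x. norm (w z * F (x - z)) \<partial>lborel) \<partial>N)"
    by (rule Fubini_integral[OF pair_int])
  also have "\<dots> = (\<integral>z. norm (w z) * (\<integral>x. norm (F x) \<partial>lborel) \<partial>N)"
    using lborel_integral_translate[of "\<lambda>x. norm (F x)"] by (simp add: norm_mult)
  finally show ?thesis
    by simp
qed

end

lemma
  assumes N: "sigma_finite_measure N" "sets N = sets borel" "integrable N w" and F: "F \<in> Xi k"
  shows Xi_wconv: "wconv N w F \<in> Xi k"
    and xi_norm_wconv_le: "xi_norm k (wconv N w F) \<le> (\<integral>z. norm (w z) \<partial>N) * xi_norm k F"
proof -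
  have F_C0k: "C0k k F" and F_int: "integrable lborel F"
    using F by (auto simp: Xi_def)
  show "wconv N w F \<in> Xi k"
    using C0k_wconv[OF N(2,3) F_C0k] integrable_wconv[OF N F_int] by (simp add: Xi_def)
  have "norm (pds bs (wconv N w F) x) \<le> (\<integral>z. norm (w z) \<partial>N) * Ck_norm k F"
    if bs: "bs \<in> multi_idx k" for bs x
  proof -
    have "pds bs F \<in> borel_measurable borel"
      using bs by (intro C0k_0_borel_measurable C0k_pds[OF F_C0k]) (auto simp: multi_idx_def)
    then show ?thesis
      unfolding pds_wconv[OF N(2,3) F_C0k bs] by (intro norm_wconv_le N norm_pds_le_Ck_norm[OF F_C0k bs])
  qed
  then show "xi_norm k (wconv N w F) \<le> (\<integral>z. norm (w z) \<partial>N) * xi_norm k F"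
    using integral_norm_wconv_le[OF N F_int] unfolding xi_norm_eq distrib_left
    by (intro add_mono Ck_norm_le)
qed

lemma schwartz_wconv:
  fixes w F :: "'a::euclidean_space \<Rightarrow> complex"
  assumes N: "sets N = sets borel" and moments: "\<And>m. integrable N (\<lambda>z. (1 + norm z) ^ m *\<^sub>R w z)"
    and F: "schwartz F"
  shows "schwartz (wconv N w F)"
proof -
  have w: "integrable N w"
    using moments[of 0] by simp
  have F_C0k: "C0k k F" for k
    using schwartz_imp_C0k[OF F] .
  have "rapidly_decreasing (pds bs (wconv N w F))" if bs: "set bs \<subseteq> Basis" for bs
  proof -
    have "pds bs (wconv N w F) = wconv N w (pds bs F)"
      using bs by (intro pds_wconv[OF N w F_C0k, where k = "length bs"]) (simp add: multi_idx_def)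
    moreover have "pds bs F \<in> borel_measurable borel" "rapidly_decreasing (pds bs F)"
      using C0k_0_borel_measurable[OF C0k_pds[OF F_C0k bs]] F bs by (auto simp: schwartz_iff)
    ultimately show ?thesis
      using rapidly_decreasing_wconv[OF N w _ _ moments] by simp
  qed
  then show ?thesis
    using C0k_wconv[OF N w F_C0k] by (auto simp: schwartz_iff C0k_def)
qed

section \<open>Integrability of rapidly decreasing functions\<close>

lemma
  fixes f :: "'a::euclidean_space \<Rightarrow> real \<Rightarrow> 'b::{real_normed_field, banach, second_countable_topology}"
  assumes f: "\<And>b. b \<in> Basis \<Longrightarrow> integrable lborel (f b)"
  shows lborel_integrable_prod_Basis: "integrable lborel (\<lambda>x. \<Prod>b\<in>Basis. f b (x \<bullet> b))"
    and lborel_integral_prod_Basis: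
      "(\<integral>x. (\<Prod>b\<in>Basis. f b (x \<bullet> b)) \<partial>lborel) = (\<Prod>b\<in>Basis. \<integral>t. f b t \<partial>lborel)"
proof -
  interpret product_sigma_finite "\<lambda>b :: 'a. lborel :: real measure"
    by standard
  let ?T = "\<lambda>x :: 'a \<Rightarrow> real. \<Sum>b\<in>Basis. x b *\<^sub>R b"
  have T_measurable: "?T \<in> measurable (\<Pi>\<^sub>M b\<in>Basis. lborel) borel"
    by measurable
  have prod_T: "(\<Prod>b\<in>Basis. f b (?T x \<bullet> b)) = (\<Prod>b\<in>Basis. f b (x b))" for x
    by (intro prod.cong) (simp_all add: inner_sum_left inner_Basis if_distrib cong: if_cong)
  have [measurable]: "(\<lambda>x. \<Prod>b\<in>Basis. f b (x \<bullet> b)) \<in> borel_measurable borel"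
  proof (intro borel_measurable_prod)
    fix b :: 'a assume "b \<in> Basis"
    then have [measurable]: "f b \<in> borel_measurable borel"
      using f by (auto dest!: borel_measurable_integrable)
    show "(\<lambda>x. f b (x \<bullet> b)) \<in> borel_measurable borel"
      by measurable
  qed
  show "integrable lborel (\<lambda>x. \<Prod>b\<in>Basis. f b (x \<bullet> b))"
    using product_integrable_prod[of Basis f] f
    by (subst lborel_eq, subst integrable_distr_eq[OF T_measurable]) (auto simp: prod_T)
  show "(\<integral>x. (\<Prod>b\<in>Basis. f b (x \<bullet> b)) \<partial>lborel) = (\<Prod>b\<in>Basis. \<integral>t. f b t \<partial>lborel)"
    using product_integral_prod[of Basis f] f
    by (subst lborel_eq, subst integral_distr[OF T_measurable]) (auto simp: prod_T)
qed

lemma prod_Basis_one_plus_square_le: "(\<Prod>b\<in>Basis. 1 + (x \<bullet> b)\<^sup>2) \<le> (1 + norm x) ^ (2 * DIM('a))"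
  for x :: "'a::euclidean_space"
proof -
  have "1 + (x \<bullet> b)\<^sup>2 \<le> (1 + norm x)\<^sup>2" if "b \<in> Basis" for b
  proof -
    have "(x \<bullet> b)\<^sup>2 \<le> (norm x)\<^sup>2"
      using Basis_le_norm[OF that, of x] by (simp add: power2_le_iff_abs_le)
    then show ?thesis
      using norm_ge_zero[of x] unfolding power2_sum one_power2 by linarith
  qed
  then have "(\<Prod>b\<in>Basis. 1 + (x \<bullet> b)\<^sup>2) \<le> (\<Prod>b\<in>(Basis :: 'a set). (1 + norm x)\<^sup>2)"
    by (intro prod_mono) auto
  then show ?thesis
    by (simp add: power_mult)
qed

lemma rapidly_decreasing_imp_integrable:
  fixes f :: "'a::euclidean_space \<Rightarrow> 'b::{banach, second_countable_topology}"
  assumes f: "f \<in> borel_measurable borel" "rapidly_decreasing f"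
  shows "integrable lborel f"
proof -
  obtain B where f_bound: "\<And>x. (1 + norm x) ^ (2 * DIM('a)) * norm (f x) \<le> B"
    using f(2) by (rule rapidly_decreasingE) blast
  show ?thesis
  proof (rule integrable_dominated)
    have "integrable lborel (\<lambda>t :: real. inverse (1 + t\<^sup>2))"
      using integrable_inverse_1_plus_square by (simp add: set_integrable_def)
    then show "integrable lborel (\<lambda>x :: 'a. B * (\<Prod>b\<in>Basis. inverse (1 + (x \<bullet> b)\<^sup>2)))"
      by (intro integrable_mult_right lborel_integrable_prod_Basis)
    fix x
    have "(\<Prod>b\<in>Basis. 1 + (x \<bullet> b)\<^sup>2) * norm (f x) \<le> B"
      using mult_right_mono[OF prod_Basis_one_plus_square_le norm_ge_zero] f_bound[of x] by (rule order_trans)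
    moreover have "(\<Prod>b\<in>Basis. 1 + (x \<bullet> b)\<^sup>2) > 0"
      by (intro prod_pos) (auto intro: add_pos_nonneg)
    ultimately show "norm (f x) \<le> B * (\<Prod>b\<in>Basis. inverse (1 + (x \<bullet> b)\<^sup>2))"
      using prod_inversef[of "\<lambda>b. 1 + (x \<bullet> b)\<^sup>2" Basis] by (simp add: o_def field_simps)
  qed (use f(1) in simp)
qed

lemma schwartz_imp_Xi:
  assumes f: "schwartz f"
  shows "f \<in> Xi k"
proof -
  have "rapidly_decreasing (pds [] f)"
    using f unfolding schwartz_iff by (elim conjE allE[of _ "[]"]) simp
  then have "integrable lborel f"
    using C0k_0_borel_measurable[OF schwartz_imp_C0k[OF f]] by (simp add: rapidly_decreasing_imp_integrable)
  then show ?thesis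
    using schwartz_imp_C0k[OF f] by (simp add: Xi_def)
qed

section \<open>The Fourier transform\<close>

lemma borel_measurable_cis [measurable]: "cis \<in> borel_measurable borel"
  by (intro borel_measurable_continuous_onI continuous_intros)

lemma cis_sum: "finite A \<Longrightarrow> cis (\<Sum>i\<in>A. f i) = (\<Prod>i\<in>A. cis (f i))"
  by (simp add: cis_conv_exp sum_distrib_left exp_sum)

lemma integrable_cis_mult:
  fixes f :: "'a::euclidean_space \<Rightarrow> complex"
  assumes "integrable lborel f"
  shows "integrable lborel (\<lambda>x. cis (\<omega> \<bullet> x) * f x)"
  using integrable_mult_bounded[OF assms, of "\<lambda>x. cis (\<omega> \<bullet> x)" 1] by (simp add: mult.commute)

lemma ift_eq_ft: "ift f x = complex_of_real (1 / (2 * pi) ^ DIM('a)) * ft f (- x)"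
  for f :: "'a::euclidean_space \<Rightarrow> complex"
  by (simp add: ift_def ft_def inner_commute)

lemma borel_measurable_ft [measurable]:
  assumes [measurable]: "f \<in> borel_measurable borel"
  shows "ft f \<in> borel_measurable borel"
  unfolding ft_def by measurable

lemma norm_ft_le: "norm (ft f \<omega>) \<le> (\<integral>x. norm (f x) \<partial>lborel)"
  unfolding ft_def by (rule order_trans[OF integral_norm_bound]) (simp add: norm_mult)

lemma ft_cmult: "ft (\<lambda>x. c * f x) \<omega> = c * ft f \<omega>"
  unfolding ft_def integral_mult_right_zero[symmetric] by (simp only: mult.left_commute)

lemma ft_lincomb:
  assumes f: "integrable lborel f" and g: "integrable lborel g"
  shows "ft (\<lambda>x. a * f x + b * g x) \<omega> = a * ft f \<omega> + b * ft g \<omega>"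
proof -
  have "ft (\<lambda>x. a * f x + b * g x) \<omega> =
    (\<integral>x. a * (cis (\<omega> \<bullet> x) * f x) + b * (cis (\<omega> \<bullet> x) * g x) \<partial>lborel)"
    by (simp add: ft_def algebra_simps)
  then show ?thesis
    using integrable_cis_mult[OF f] integrable_cis_mult[OF g] by (simp add: ft_def)
qed

lemma integral_directional_derivative_eq_0:
  fixes f :: "'a::euclidean_space \<Rightarrow> 'b::euclidean_space"
  assumes f': "\<And>x. (f has_derivative f' x) (at x)" and cont: "continuous_on UNIV (\<lambda>x. f' x v)"
    and f_int: "integrable lborel f" and f'_int: "integrable lborel (\<lambda>x. f' x v)"
  shows "(\<integral>x. f' x v \<partial>lborel) = 0"
proof -
  let ?I = "\<lambda>t :: real. indicator {0..1} t :: real"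
  have [measurable]: "(\<lambda>x. f' x v) \<in> borel_measurable borel"
    using cont by (rule borel_measurable_continuous_onI)
  have FTC: "(\<integral>t. ?I t *\<^sub>R f' (x + t *\<^sub>R v) v \<partial>lborel) = f (x + v) - f x" for x
  proof -
    have "((\<lambda>t. f (x + t *\<^sub>R v)) has_vector_derivative f' (x + t *\<^sub>R v) v) (at t within {0..1})" for t
      unfolding has_vector_derivative_def linear_scale[OF has_derivative_linear[OF f'], symmetric]
      by (rule has_derivative_compose[OF _ f']) (auto intro!: derivative_eq_intros)
    moreover have "continuous_on {0..1} (\<lambda>t. f' (x + t *\<^sub>R v) v)"
      by (intro continuous_on_compose2[OF cont] continuous_intros) auto
    ultimately show ?thesis
      using integral_FTC_Icc[of 0 1 "\<lambda>t. f (x + t *\<^sub>R v)"] by simp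
  qed
  have translate: "integrable lborel (\<lambda>x. f' (x + t *\<^sub>R v) v)"
    "(\<integral>x. f' (x + t *\<^sub>R v) v \<partial>lborel) = (\<integral>x. f' x v \<partial>lborel)"
    "(\<integral>x. norm (f' (x + t *\<^sub>R v) v) \<partial>lborel) = (\<integral>x. norm (f' x v) \<partial>lborel)" for t
    using lborel_integrable_translate[OF f'_int, of "- (t *\<^sub>R v)"]
      lborel_integral_translate[of "\<lambda>x. f' x v" "- (t *\<^sub>R v)"]
      lborel_integral_translate[of "\<lambda>x. norm (f' x v)" "- (t *\<^sub>R v)"] by auto
  have "integrable (lborel \<Otimes>\<^sub>M lborel) (\<lambda>(t, x). ?I t *\<^sub>R f' (x + t *\<^sub>R v) v)"
    by (rule lborel_pair.Fubini_integrable) (use translate in auto)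
  then have "(\<integral>x. (\<integral>t. ?I t *\<^sub>R f' (x + t *\<^sub>R v) v \<partial>lborel) \<partial>lborel) =
      (\<integral>t. (\<integral>x. ?I t *\<^sub>R f' (x + t *\<^sub>R v) v \<partial>lborel) \<partial>lborel)"
    by (rule lborel_pair.Fubini_integral)
  also have "\<dots> = (\<integral>x. f' x v \<partial>lborel)"
    by (simp add: translate)
  also have "(\<integral>x. (\<integral>t. ?I t *\<^sub>R f' (x + t *\<^sub>R v) v \<partial>lborel) \<partial>lborel) = 0"
    using lborel_integrable_translate[OF f_int, of "- v"] lborel_integral_translate[of f "- v"] f_int
    by (simp add: FTC)
  finally show ?thesis
    by simp
qed

lemma ft_partial_derivative:
  fixes f :: "'a::euclidean_space \<Rightarrow> complex"
  assumes f: "Ck 1 f" "integrable lborel f" and b: "b \<in> Basis" and Df: "integrable lborel (pds [b] f)"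
  shows "ft (pds [b] f) \<omega> = - \<i> * complex_of_real (\<omega> \<bullet> b) * ft f \<omega>"
proof -
  let ?f' = "\<lambda>x. frechet_derivative f (at x)"
  define D where "D x h =
      cis (\<omega> \<bullet> x) * ?f' x h + \<i> * complex_of_real (\<omega> \<bullet> h) * cis (\<omega> \<bullet> x) * f x" for x h
  have f': "(f has_derivative ?f' x) (at x)" for x
    using Ck_has_derivative[OF f(1), of "[]"] by simp
  have D_derivative: "((\<lambda>x. cis (\<omega> \<bullet> x) * f x) has_derivative D x) (at x)" for x
    unfolding D_def by (auto intro!: derivative_eq_intros f' simp: scaleR_conv_of_real)
  have D_b: "D x b = cis (\<omega> \<bullet> x) * pds [b] f x + \<i> * complex_of_real (\<omega> \<bullet> b) * (cis (\<omega> \<bullet> x) * f x)" for x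
    by (simp add: D_def)
  have "(\<integral>x. D x b \<partial>lborel) = 0"
  proof (rule integral_directional_derivative_eq_0[OF D_derivative])
    show "continuous_on UNIV (\<lambda>x. D x b)"
      unfolding D_b using Ck_continuous_pds[OF f(1)] Ck_continuous_pds[OF f(1), of "[]"] b
      by (intro continuous_intros) (auto simp: multi_idx_def simp del: pds.simps(2))
    show "integrable lborel (\<lambda>x. D x b)"
      unfolding D_b
      by (intro Bochner_Integration.integrable_add integrable_mult_right integrable_cis_mult f Df)
  qed (intro integrable_cis_mult f)
  then show ?thesis
    using integrable_cis_mult[OF f(2)] integrable_cis_mult[OF Df] unfolding D_b
    by (simp add: ft_def add_eq_0_iff2 del: pds.simps)
qed

lemma norm_mult_norm_ft_le:
  fixes f :: "'a::euclidean_space \<Rightarrow> complex"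
  assumes f: "Ck 1 f" "integrable lborel f" and Df: "\<And>b. b \<in> Basis \<Longrightarrow> integrable lborel (pds [b] f)"
  shows "norm \<omega> * norm (ft f \<omega>) \<le> (\<Sum>b\<in>Basis. norm (ft (pds [b] f) \<omega>))"
proof -
  have "norm (ft (pds [b] f) \<omega>) = \<bar>\<omega> \<bullet> b\<bar> * norm (ft f \<omega>)" if "b \<in> Basis" for b
    using ft_partial_derivative[OF f that Df[OF that], of \<omega>] by (simp add: norm_mult del: pds.simps)
  then show ?thesis
    using mult_right_mono[OF norm_le_l1[of \<omega>], of "norm (ft f \<omega>)"]
    by (simp add: sum_distrib_right del: pds.simps)
qed

lemma rapidly_decreasing_ft:
  fixes f :: "'a::euclidean_space \<Rightarrow> complex"
  assumes "schwartz f"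
  shows "rapidly_decreasing (ft f)"
proof -
  have "\<exists>C. \<forall>\<omega>. (1 + norm \<omega>) ^ N * norm (ft f \<omega>) \<le> C" for N
    using assms
  proof (induction N arbitrary: f)
    case 0
    then show ?case
      using norm_ft_le by auto
  next
    case (Suc N)
    have pds: "schwartz (pds [b] f)" if "b \<in> Basis" for b
      using Suc.prems that by (intro schwartz_pds) auto
    then have "\<forall>b\<in>Basis. \<exists>C. \<forall>\<omega>. (1 + norm \<omega>) ^ N * norm (ft (pds [b] f) \<omega>) \<le> C"
      using Suc.IH by blast
    then obtain C where pds_bound: "\<And>b \<omega>. b \<in> Basis \<Longrightarrow> (1 + norm \<omega>) ^ N * norm (ft (pds [b] f) \<omega>) \<le> C b"
      by metis
    obtain C0 where f_bound: "\<And>\<omega>. (1 + norm \<omega>) ^ N * norm (ft f \<omega>) \<le> C0"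
      using Suc by blast
    have "(1 + norm \<omega>) ^ Suc N * norm (ft f \<omega>) \<le> C0 + (\<Sum>b\<in>Basis. C b)" for \<omega>
    proof -
      have "norm \<omega> * norm (ft f \<omega>) \<le> (\<Sum>b\<in>Basis. norm (ft (pds [b] f) \<omega>))"
        by (intro norm_mult_norm_ft_le schwartz_imp_Ck Xi_integrable[OF schwartz_imp_Xi] Suc.prems pds)
      then have "(1 + norm \<omega>) ^ N * ((1 + norm \<omega>) * norm (ft f \<omega>)) \<le>
          (1 + norm \<omega>) ^ N * (norm (ft f \<omega>) + (\<Sum>b\<in>Basis. norm (ft (pds [b] f) \<omega>)))"
        by (intro mult_left_mono) (auto simp: distrib_right)
      also have "\<dots> \<le> C0 + (\<Sum>b\<in>Basis. C b)"
        unfolding distrib_left sum_distrib_left by (intro add_mono sum_mono pds_bound f_bound)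
      finally show ?thesis
        by (simp add: mult_ac)
    qed
    then show ?case
      by blast
  qed
  then show ?thesis
    by (simp add: rapidly_decreasing_def)
qed

lemma ft_wconv:
  assumes N: "sigma_finite_measure N" "sets N = sets borel" "integrable N w" and F: "integrable lborel F"
  shows "ft (wconv N w F) \<omega> = (\<integral>z. w z * cis (\<omega> \<bullet> z) \<partial>N) * ft F \<omega>"
proof -
  have "ft (wconv N w F) \<omega> = (\<integral>z. w z * (\<integral>x. cis (\<omega> \<bullet> x) * F (x - z) \<partial>lborel) \<partial>N)"
    unfolding ft_def by (rule integral_mult_wconv[OF N F, where B = 1]) simp_all
  moreover have "(\<integral>x. cis (\<omega> \<bullet> x) * F (x - z) \<partial>lborel) = cis (\<omega> \<bullet> z) * ft F \<omega>" for z
  proof -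
    have "cis (\<omega> \<bullet> x) * F (x - z) = cis (\<omega> \<bullet> z) * (cis (\<omega> \<bullet> (x - z)) * F (x - z))" for x
      by (simp add: cis_mult inner_diff_right flip: mult.assoc)
    then show ?thesis
      unfolding ft_def lborel_integral_translate[of "\<lambda>x. cis (\<omega> \<bullet> x) * F x" z, symmetric]
      by (simp only: integral_mult_right_zero)
  qed
  ultimately show ?thesis
    by (simp flip: mult.assoc)
qed

lemma integral_bounded_kernel_swap:
  fixes f :: "'s \<Rightarrow> 'b::{real_normed_field, banach, second_countable_topology}"
  assumes "pair_sigma_finite A B" and f: "integrable A f" and g: "integrable B g"
    and [measurable]: "(\<lambda>(x, y). c x y) \<in> borel_measurable (A \<Otimes>\<^sub>M B)"
    and c_bounded: "\<And>x y. norm (c x y) \<le> K"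
  shows "(\<integral>y. g y * (\<integral>x. c x y * f x \<partial>A) \<partial>B) = (\<integral>x. f x * (\<integral>y. c x y * g y \<partial>B) \<partial>A)"
proof -
  interpret pair_sigma_finite A B by fact
  have "integrable (A \<Otimes>\<^sub>M B) (\<lambda>p. f (fst p) * g (snd p))"
    by (rule Fubini_integrable) (use f g in \<open>auto simp: norm_mult\<close>)
  then have "integrable (A \<Otimes>\<^sub>M B) (\<lambda>(x, y). f x * g y * c x y)"
    using integrable_mult_bounded[of "A \<Otimes>\<^sub>M B" "\<lambda>p. f (fst p) * g (snd p)" "\<lambda>(x, y). c x y" K] c_bounded
    by (simp add: case_prod_beta')
  then have "(\<integral>y. (\<integral>x. f x * g y * c x y \<partial>A) \<partial>B) = (\<integral>x. (\<integral>y. f x * g y * c x y \<partial>B) \<partial>A)"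
    by (rule Fubini_integral)
  moreover have "(\<integral>x. f x * g y * c x y \<partial>A) = g y * (\<integral>x. c x y * f x \<partial>A)" for y
    unfolding integral_mult_right_zero[symmetric] by (simp add: mult_ac)
  moreover have "(\<integral>y. f x * g y * c x y \<partial>B) = f x * (\<integral>y. c x y * g y \<partial>B)" for x
    unfolding integral_mult_right_zero[symmetric] by (simp add: mult_ac)
  ultimately show ?thesis
    by simp
qed

lemma ft_ft_mult:
  fixes f h :: "'a::euclidean_space \<Rightarrow> complex"
  assumes f: "integrable lborel f" and h: "integrable lborel h"
  shows "ft (\<lambda>\<omega>. ft f \<omega> * h \<omega>) (- z) = wconv lborel f (\<lambda>x. ft h (- x)) z"
proof -
  have "ft (\<lambda>\<omega>. ft f \<omega> * h \<omega>) (- z) =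
      (\<integral>\<omega>. (cis (- z \<bullet> \<omega>) * h \<omega>) * (\<integral>x. cis (\<omega> \<bullet> x) * f x \<partial>lborel) \<partial>lborel)"
    by (simp add: ft_def mult_ac)
  also have "\<dots> = (\<integral>x. f x * (\<integral>\<omega>. cis (\<omega> \<bullet> x) * (cis (- z \<bullet> \<omega>) * h \<omega>) \<partial>lborel) \<partial>lborel)"
    by (intro integral_bounded_kernel_swap[where K = 1] lborel_pair.pair_sigma_finite_axioms
        integrable_cis_mult f h) auto
  also have "\<dots> = wconv lborel f (\<lambda>x. ft h (- x)) z"
    by (simp add: wconv_def ft_def cis_mult inner_diff_left inner_diff_right inner_commute flip: mult.assoc)
  finally show ?thesis .
qed

section \<open>Gaussians\<close>

definition gauss :: "real \<Rightarrow> 'a::euclidean_space \<Rightarrow> real" where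
  "gauss s x = exp (- (norm x / s)\<^sup>2 / 2) / (s * sqrt (2 * pi)) ^ DIM('a)"

definition gauss_ft :: "real \<Rightarrow> 'a::euclidean_space \<Rightarrow> real" where
  "gauss_ft s \<omega> = exp (- (s * norm \<omega>)\<^sup>2 / 2)"

abbreviation cgauss :: "real \<Rightarrow> 'a::euclidean_space \<Rightarrow> complex" where
  "cgauss s \<equiv> \<lambda>x. complex_of_real (gauss s x)"

abbreviation cgauss_ft :: "real \<Rightarrow> 'a::euclidean_space \<Rightarrow> complex" where
  "cgauss_ft s \<equiv> \<lambda>\<omega>. complex_of_real (gauss_ft s \<omega>)"

lemma gauss_nonneg [simp]: "s > 0 \<Longrightarrow> 0 \<le> gauss s x"
  by (simp add: gauss_def)

lemma gauss_minus [simp]: "gauss s (- x) = gauss s x"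
  by (simp add: gauss_def)

lemma gauss_ft_minus [simp]: "gauss_ft s (- \<omega>) = gauss_ft s \<omega>"
  by (simp add: gauss_ft_def)

lemma borel_measurable_gauss [measurable]: "gauss s \<in> borel_measurable borel"
  unfolding gauss_def by measurable

lemma borel_measurable_gauss_ft [measurable]: "gauss_ft s \<in> borel_measurable borel"
  unfolding gauss_ft_def by measurable

lemma gauss_eq_gauss_ft: "gauss s x = gauss_ft (1 / s) x / (s * sqrt (2 * pi)) ^ DIM('a)"
  for x :: "'a::euclidean_space"
  by (simp add: gauss_def gauss_ft_def)

lemma power2_norm_eq_sum_Basis: "(norm x)\<^sup>2 = (\<Sum>b\<in>Basis. (x \<bullet> b)\<^sup>2)" for x :: "'a::euclidean_space"
  unfolding power2_norm_eq_inner by (subst euclidean_inner) (simp add: power2_eq_square)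

lemma gauss_eq_prod:
  fixes x :: "'a::euclidean_space"
  assumes "s > 0"
  shows "gauss s x = (\<Prod>b\<in>Basis. normal_density 0 s (x \<bullet> b))"
proof -
  have "normal_density 0 s t = exp (- (t / s)\<^sup>2 / 2) / (s * sqrt (2 * pi))" for t
    using assms by (simp add: normal_density_def real_sqrt_mult power_divide mult_ac)
  then have "(\<Prod>b\<in>Basis. normal_density 0 s (x \<bullet> b)) =
      exp (\<Sum>b\<in>Basis. - (x \<bullet> b / s)\<^sup>2 / 2) / (s * sqrt (2 * pi)) ^ DIM('a)"
    by (simp add: prod_dividef exp_sum)
  also have "(\<Sum>b\<in>Basis. - (x \<bullet> b / s)\<^sup>2 / 2) = - (norm x / s)\<^sup>2 / 2"
    by (simp add: power_divide power2_norm_eq_sum_Basis sum_negf flip: sum_divide_distrib)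
  finally show ?thesis
    by (simp add: gauss_def)
qed

lemma integral_cis_normal_density:
  assumes "s > 0"
  shows "(\<integral>x. cis (t * x) * complex_of_real (normal_density 0 s x) \<partial>lborel) =
    complex_of_real (exp (- (s * t)\<^sup>2 / 2))"
proof -
  have scale: "s * normal_density 0 s (s * x) = std_normal_density x" for x
    using assms by (simp add: normal_density_def real_sqrt_mult power_mult_distrib)
  have "(\<integral>x. cis (t * x) * complex_of_real (normal_density 0 s x) \<partial>lborel) =
    (\<integral>x. s *\<^sub>R (cis (t * (s * x)) * complex_of_real (normal_density 0 s (s * x))) \<partial>lborel)"
    using assms by (subst lborel_integral_real_affine[of s _ 0]) auto
  also have "\<dots> = (\<integral>x. std_normal_density x *\<^sub>R cis ((s * t) * x) \<partial>lborel)"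
    by (intro Bochner_Integration.integral_cong) (auto simp: scaleR_conv_of_real ac_simps simp flip: scale)
  also have "\<dots> = char std_normal_distribution (s * t)"
    unfolding char_def by (subst integral_density) (auto simp: cis_conv_exp)
  finally show ?thesis
    by (simp add: char_std_normal_distribution)
qed

lemma ft_gauss:
  fixes \<omega> :: "'a::euclidean_space"
  assumes s: "s > 0"
  shows "ft (cgauss s) \<omega> = cgauss_ft s \<omega>"
proof -
  define h where "h b t = cis ((\<omega> \<bullet> b) * t) * complex_of_real (normal_density 0 s t)" for b :: 'a and t
  have h_int: "integrable lborel (h b)" for b
    unfolding h_def
    using integrable_cis_mult[of "\<lambda>t. complex_of_real (normal_density 0 s t)" "\<omega> \<bullet> b"] s by simp
  have "cis (\<omega> \<bullet> x) * cgauss s x = (\<Prod>b\<in>Basis. h b (x \<bullet> b))" for x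
    using s by (simp add: h_def prod.distrib gauss_eq_prod cis_sum euclidean_inner[of \<omega> x])
  then have "ft (cgauss s) \<omega> = (\<Prod>b\<in>Basis. complex_of_real (exp (- (s * (\<omega> \<bullet> b))\<^sup>2 / 2)))"
    using h_int
    by (simp add: ft_def lborel_integral_prod_Basis) (simp add: h_def integral_cis_normal_density s)
  also have "\<dots> = complex_of_real (exp (\<Sum>b\<in>Basis. - (s * (\<omega> \<bullet> b))\<^sup>2 / 2))"
    by (simp only: of_real_prod exp_sum finite_Basis)
  also have "(\<Sum>b\<in>Basis. - (s * (\<omega> \<bullet> b))\<^sup>2 / 2) = - (s * norm \<omega>)\<^sup>2 / 2"
    by (simp add: power_mult_distrib power2_norm_eq_sum_Basis sum_negf sum_distrib_left
        flip: sum_divide_distrib)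
  finally show ?thesis
    by (simp add: gauss_ft_def)
qed

lemma ft_gauss_ft:
  fixes x :: "'a::euclidean_space"
  assumes s: "s > 0"
  shows "ft (cgauss_ft s) x = complex_of_real ((2 * pi) ^ DIM('a)) * cgauss s x"
proof -
  have sqrt_eq: "sqrt (2 * pi) / s = 2 * pi / (s * sqrt (2 * pi))"
    using s by (simp add: field_simps)
  have "cgauss_ft s = (\<lambda>\<omega> :: 'a. complex_of_real ((sqrt (2 * pi) / s) ^ DIM('a)) * cgauss (1 / s) \<omega>)"
    using s by (auto simp: gauss_eq_gauss_ft power_divide)
  then have "ft (cgauss_ft s) x = complex_of_real ((sqrt (2 * pi) / s) ^ DIM('a)) * ft (cgauss (1 / s)) x"
    by (simp only: ft_cmult)
  also have "ft (cgauss (1 / s)) x = cgauss_ft (1 / s) x"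
    using s by (simp add: ft_gauss)
  also have "complex_of_real ((sqrt (2 * pi) / s) ^ DIM('a)) * cgauss_ft (1 / s) x =
      complex_of_real ((2 * pi) ^ DIM('a)) * cgauss s x"
    by (simp add: gauss_eq_gauss_ft sqrt_eq power_divide)
  finally show ?thesis .
qed

lemma power_mult_exp_le:
  fixes t :: real
  assumes "t \<ge> 0" "a > 0"
  shows "(1 + t) ^ n * exp (- (a * t)\<^sup>2 / 2) \<le> exp ((n / a)\<^sup>2 / 2)"
proof -
  have "(1 + t) ^ n * exp (- (a * t)\<^sup>2 / 2) \<le> exp t ^ n * exp (- (a * t)\<^sup>2 / 2)"
    using assms exp_ge_add_one_self[of t] by (intro mult_right_mono power_mono) auto
  also have "\<dots> = exp (n * t - (a * t)\<^sup>2 / 2)"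
    by (simp flip: exp_of_nat_mult exp_add)
  also have "n * t - (a * t)\<^sup>2 / 2 \<le> (n / a)\<^sup>2 / 2"
  proof -
    have "0 \<le> (n / a - a * t)\<^sup>2"
      by simp
    also have "\<dots> = (n / a)\<^sup>2 + (a * t)\<^sup>2 - 2 * (n * t)"
      using assms by (simp add: power2_diff)
    finally show ?thesis
      by simp
  qed
  finally show ?thesis
    by simp
qed

lemma rapidly_decreasing_gauss_ft:
  assumes "s > 0"
  shows "rapidly_decreasing (cgauss_ft s)"
  unfolding rapidly_decreasing_def
proof
  fix n
  have "(1 + norm \<omega>) ^ n * norm (cgauss_ft s \<omega>) \<le> exp ((n / s)\<^sup>2 / 2)" for \<omega> :: 'a
    using power_mult_exp_le[of "norm \<omega>" s n] assms by (simp add: gauss_ft_def)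
  then show "\<exists>B. \<forall>\<omega> :: 'a. (1 + norm \<omega>) ^ n * norm (cgauss_ft s \<omega>) \<le> B"
    by blast
qed

lemma rapidly_decreasing_gauss:
  assumes "s > 0"
  shows "rapidly_decreasing (cgauss s :: 'a::euclidean_space \<Rightarrow> complex)"
proof -
  have "cgauss s = (\<lambda>x :: 'a. cgauss_ft (1 / s) x / complex_of_real ((s * sqrt (2 * pi)) ^ DIM('a)))"
    by (auto simp: gauss_eq_gauss_ft)
  then show ?thesis
    using assms
    by (simp only:)
      (intro rapidly_decreasing_bounded_linear[OF bounded_linear_divide] rapidly_decreasing_gauss_ft; simp)
qed

lemma integrable_gauss_ft: "s > 0 \<Longrightarrow> integrable lborel (cgauss_ft s)"
  by (intro rapidly_decreasing_imp_integrable rapidly_decreasing_gauss_ft) measurable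

lemma integrable_gauss: "s > 0 \<Longrightarrow> integrable lborel (cgauss s)"
  by (intro rapidly_decreasing_imp_integrable rapidly_decreasing_gauss) measurable

lemma integral_gauss:
  assumes "s > 0"
  shows "(\<integral>x. gauss s x \<partial>lborel) = 1"
  using ft_gauss[OF assms, of 0] by (simp add: ft_def gauss_ft_def)

lemma real_polynomial_function_has_derivative:
  fixes p :: "'a::real_normed_vector \<Rightarrow> real"
  assumes "real_polynomial_function p"
  shows "\<exists>p'. (\<forall>x. (p has_derivative p' x) (at x)) \<and> (\<forall>h. real_polynomial_function (\<lambda>x. p' x h))"
  using assms
proof induction
  case (linear f)
  then show ?case
    by (intro exI[of _ "\<lambda>_. f"]) (auto intro: bounded_linear_imp_has_derivative)
next
  case (const c)
  then show ?case
    by (intro exI[of _ "\<lambda>_ _. 0"]) auto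
next
  case (add f g)
  then obtain f' g' where "\<forall>x. (f has_derivative f' x) (at x)" "\<forall>h. real_polynomial_function (\<lambda>x. f' x h)"
    "\<forall>x. (g has_derivative g' x) (at x)" "\<forall>h. real_polynomial_function (\<lambda>x. g' x h)"
    by blast
  then show ?case
    by (intro exI[of _ "\<lambda>x h. f' x h + g' x h"]) (auto intro: has_derivative_add)
next
  case (mult f g)
  then obtain f' g' where "\<forall>x. (f has_derivative f' x) (at x)" "\<forall>h. real_polynomial_function (\<lambda>x. f' x h)"
    "\<forall>x. (g has_derivative g' x) (at x)" "\<forall>h. real_polynomial_function (\<lambda>x. g' x h)"
    by blast
  then show ?case
    using mult by (intro exI[of _ "\<lambda>x h. f x * g' x h + f' x h * g x"])
      (auto intro!: has_derivative_mult real_polynomial_function.intros(3,4))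
qed

lemma has_derivative_gauss:
  fixes x :: "'a::euclidean_space"
  assumes "s > 0"
  shows "(gauss s has_derivative (\<lambda>h. - (x \<bullet> h) / s\<^sup>2 * gauss s x)) (at x)"
proof -
  have gauss: "gauss s = (\<lambda>x :: 'a. exp (- (x \<bullet> x) / (2 * s\<^sup>2)) * (1 / (s * sqrt (2 * pi)) ^ DIM('a)))"
    by (simp add: fun_eq_iff gauss_def power_divide power2_norm_eq_inner)
  show ?thesis
    unfolding gauss using assms by (auto intro!: derivative_eq_intros simp: inner_commute divide_simps)
qed

lemma pds_gauss:
  assumes "s > 0"
  shows "\<exists>q. real_polynomial_function q \<and>
    pds bs (cgauss s) = (\<lambda>x. q x *\<^sub>R cgauss s (x :: 'a::euclidean_space))"
proof (induction bs)
  case Nil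
  then show ?case
    by (intro exI[of _ "\<lambda>_. 1"]) auto
next
  case (Cons b bs)
  then obtain q where q: "real_polynomial_function q" "pds bs (cgauss s) = (\<lambda>x :: 'a. q x *\<^sub>R cgauss s x)"
    by blast
  obtain q' where q': "\<And>x. (q has_derivative q' x) (at x)" "\<And>h. real_polynomial_function (\<lambda>x. q' x h)"
    using real_polynomial_function_has_derivative[OF q(1)] by blast
  let ?p = "\<lambda>x. q x * (- (x \<bullet> b) / s\<^sup>2) + q' x b"
  have "((\<lambda>x. q x *\<^sub>R cgauss s x) has_derivative
      (\<lambda>h. q x *\<^sub>R complex_of_real (- (x \<bullet> h) / s\<^sup>2 * gauss s x) + q' x h *\<^sub>R cgauss s x)) (at x)" for x
    by (intro has_derivative_scaleR has_derivative_of_real q' has_derivative_gauss assms)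
  from frechet_derivative_at[OF this, symmetric]
  have "pds (b # bs) (cgauss s) = (\<lambda>x. ?p x *\<^sub>R cgauss s x)"
    by (simp add: q(2) algebra_simps scaleR_conv_of_real)
  moreover have "real_polynomial_function ?p"
    using q(1) q'(2) by (intro real_polynomial_function.intros(3,4) real_polynomial_function_divide
        real_polynomial_function_minus)
      (auto intro: real_polynomial_function.intros(1) bounded_linear_inner_left)
  ultimately show ?case
    by blast
qed

lemma schwartz_gauss:
  assumes "s > 0"
  shows "schwartz (cgauss s :: 'a::euclidean_space \<Rightarrow> complex)"
proof -
  have pds_differentiable: "pds bs (cgauss s) differentiable at x" for bs and x :: 'a
  proof -
    obtain q where q: "real_polynomial_function q" "pds bs (cgauss s) = (\<lambda>x :: 'a. q x *\<^sub>R cgauss s x)"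
      using pds_gauss[OF assms] by blast
    obtain q' where "(q has_derivative q' x) (at x)"
      using real_polynomial_function_has_derivative[OF q(1)] by blast
    from has_derivative_scaleR[OF this has_derivative_of_real[OF has_derivative_gauss[OF assms]]]
    show ?thesis
      unfolding q(2) differentiable_def by blast
  qed
  then have "continuous_on UNIV (pds bs (cgauss s :: 'a \<Rightarrow> complex))" for bs
    by (simp add: continuous_on_eq_continuous_at differentiable_imp_continuous_within)
  moreover have "rapidly_decreasing (pds bs (cgauss s :: 'a \<Rightarrow> complex))" for bs
    using pds_gauss[OF assms, of bs]
      rapidly_decreasing_polynomial_scaleR[OF _ rapidly_decreasing_gauss[OF assms]]
    by auto
  ultimately show ?thesis
    using pds_differentiable by (simp add: schwartz_iff Ck_def)
qed

section \<open>Bounded functionals on seminormed spaces of functions\<close>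

definition bounded_functionals ::
    "('a \<Rightarrow> 'b) set \<Rightarrow> (('a \<Rightarrow> 'b) \<Rightarrow> real) \<Rightarrow> (('a \<Rightarrow> 'b) \<Rightarrow> 'b::real_normed_field) set" where
  "bounded_functionals E p =
    {L. (\<forall>f\<in>E. \<forall>g\<in>E. \<forall>a b. L (\<lambda>x. a * f x + b * g x) = a * L f + b * L g) \<and>
      (\<exists>C. \<forall>f\<in>E. norm (L f) \<le> C * p f)}"

locale seminormed_functions =
  fixes E :: "('a \<Rightarrow> 'b::{real_normed_field, banach}) set" and p :: "('a \<Rightarrow> 'b) \<Rightarrow> real"
  assumes lincomb: "\<And>f g a b. f \<in> E \<Longrightarrow> g \<in> E \<Longrightarrow> (\<lambda>x. a * f x + b * g x) \<in> E"
    and seminorm_lincomb: "\<And>f g a b. f \<in> E \<Longrightarrow> g \<in> E \<Longrightarrow>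
      p (\<lambda>x. a * f x + b * g x) \<le> norm a * p f + norm b * p g"
begin

lemma diff_mem: "f \<in> E \<Longrightarrow> g \<in> E \<Longrightarrow> (\<lambda>x. f x - g x) \<in> E"
  using lincomb[of f g 1 "- 1"] by simp

lemma seminorm_diff_triangle:
  assumes "f \<in> E" "g \<in> E" "h \<in> E"
  shows "p (\<lambda>x. f x - h x) \<le> p (\<lambda>x. f x - g x) + p (\<lambda>x. g x - h x)"
  using seminorm_lincomb[OF diff_mem[OF assms(1,2)] diff_mem[OF assms(2,3)], of 1 1] by simp

lemma seminorm_le_diff:
  assumes "f \<in> E" "g \<in> E"
  shows "p f \<le> p (\<lambda>x. f x - g x) + p g"
  using seminorm_lincomb[OF diff_mem[OF assms] assms(2), of 1 1] by simp

lemma seminorm_diff_commute: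
  assumes "f \<in> E" "g \<in> E"
  shows "p (\<lambda>x. f x - g x) = p (\<lambda>x. g x - f x)"
  using seminorm_lincomb[OF diff_mem[OF assms] diff_mem[OF assms], of "- 1" 0]
    seminorm_lincomb[OF diff_mem[OF assms(2,1)] diff_mem[OF assms(2,1)], of "- 1" 0] by simp

lemma seminorm_nonneg:
  assumes "f \<in> E"
  shows "0 \<le> p f"
  using seminorm_lincomb[OF assms assms, of 0 1] seminorm_lincomb[OF assms assms, of 1 "- 1"]
    seminorm_lincomb[OF assms lincomb[OF assms assms, of 1 "- 1"], of 1 1] by simp

lemma seminorm_lincomb_tendsto_0:
  assumes f: "f \<in> E" "\<And>n. fs n \<in> E" "(\<lambda>n. p (\<lambda>x. fs n x - f x)) \<longlonglongrightarrow> 0"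
    and g: "g \<in> E" "\<And>n. gs n \<in> E" "(\<lambda>n. p (\<lambda>x. gs n x - g x)) \<longlonglongrightarrow> 0"
  shows "(\<lambda>n. p (\<lambda>x. (a * fs n x + b * gs n x) - (a * f x + b * g x))) \<longlonglongrightarrow> 0"
proof (rule tendsto_sandwich[OF _ _ tendsto_const])
  show "\<forall>\<^sub>F n in sequentially. 0 \<le> p (\<lambda>x. (a * fs n x + b * gs n x) - (a * f x + b * g x))"
    by (intro always_eventually allI seminorm_nonneg diff_mem lincomb f g)
  show "\<forall>\<^sub>F n in sequentially. p (\<lambda>x. (a * fs n x + b * gs n x) - (a * f x + b * g x)) \<le>
      norm a * p (\<lambda>x. fs n x - f x) + norm b * p (\<lambda>x. gs n x - g x)"
    using seminorm_lincomb[OF diff_mem[OF f(2,1)] diff_mem[OF g(2,1)]]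
    by (intro always_eventually) (simp add: algebra_simps)
  show "(\<lambda>n. norm a * p (\<lambda>x. fs n x - f x) + norm b * p (\<lambda>x. gs n x - g x)) \<longlonglongrightarrow> 0"
    using tendsto_mult_right_zero[OF f(3)] tendsto_mult_right_zero[OF g(3)] by (rule tendsto_add_zero)
qed

lemma bounded_functionals_tendsto:
  assumes L: "L \<in> bounded_functionals E p" and f: "f \<in> E" and fs: "\<And>n. fs n \<in> E"
    and lim: "(\<lambda>n. p (\<lambda>x. fs n x - f x)) \<longlonglongrightarrow> 0"
  shows "(\<lambda>n. L (fs n)) \<longlonglongrightarrow> L f"
proof -
  obtain C where L_bound: "\<forall>g\<in>E. norm (L g) \<le> C * p g"
    using L unfolding bounded_functionals_def by blast
  have "L (\<lambda>x. 1 * fs n x + - 1 * f x) = 1 * L (fs n) + - 1 * L f" for n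
    using L f fs[of n] unfolding bounded_functionals_def by blast
  then have L_diff: "norm (L (fs n) - L f) \<le> C * p (\<lambda>x. fs n x - f x)" for n
    using bspec[OF L_bound diff_mem[OF fs[of n] f]] by simp
  have "(\<lambda>n. L (fs n) - L f) \<longlonglongrightarrow> 0"
    by (rule Lim_null_comparison[OF always_eventually[OF allI[OF L_diff]] tendsto_mult_right_zero[OF lim]])
  then show ?thesis
    by (simp add: LIM_zero_iff)
qed

end

locale dense_functions = seminormed_functions E p
  for E D :: "('a \<Rightarrow> 'b::{real_normed_field, banach}) set" and p +
  assumes dense_subset: "D \<subseteq> E"
    and dense_lincomb: "\<And>f g a b. f \<in> D \<Longrightarrow> g \<in> D \<Longrightarrow> (\<lambda>x. a * f x + b * g x) \<in> D"
    and dense: "\<And>f e. f \<in> E \<Longrightarrow> e > 0 \<Longrightarrow> \<exists>h\<in>D. p (\<lambda>x. h x - f x) < e"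
begin

lemma dense_sequence:
  assumes f: "f \<in> E"
  shows "\<exists>h. (\<forall>n. h n \<in> D) \<and> (\<lambda>n. p (\<lambda>x. h n x - f x)) \<longlonglongrightarrow> 0"
proof -
  have "\<forall>n. \<exists>h. h \<in> D \<and> p (\<lambda>x. h x - f x) < inverse (real (Suc n))"
    using dense[OF f] by (simp add: Bex_def)
  then obtain h where h: "\<And>n. h n \<in> D" "\<And>n. p (\<lambda>x. h n x - f x) < inverse (real (Suc n))"
    by metis
  have "0 \<le> p (\<lambda>x. h n x - f x)" for n
    using h(1)[of n] dense_subset f by (intro seminorm_nonneg diff_mem) auto
  then have "(\<lambda>n. p (\<lambda>x. h n x - f x)) \<longlonglongrightarrow> 0"
    using h(2) by (intro tendsto_sandwich[OF _ _ tendsto_const LIMSEQ_inverse_real_of_nat])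
      (auto intro!: always_eventually less_imp_le)
  then show ?thesis
    using h(1) by blast
qed

lemma bounded_functionals_eqI:
  assumes "L \<in> bounded_functionals E p" "L' \<in> bounded_functionals E p"
    and agree: "\<And>h. h \<in> D \<Longrightarrow> L h = L' h" and f: "f \<in> E"
  shows "L f = L' f"
proof -
  obtain h where h: "\<And>n. h n \<in> D" "(\<lambda>n. p (\<lambda>x. h n x - f x)) \<longlonglongrightarrow> 0"
    using dense_sequence[OF f] by blast
  have "h n \<in> E" for n
    using h(1) dense_subset by blast
  then have "(\<lambda>n. L (h n)) \<longlonglongrightarrow> L f" "(\<lambda>n. L' (h n)) \<longlonglongrightarrow> L' f"
    using assms(1,2) f h(2) by (auto intro: bounded_functionals_tendsto)
  then show ?thesis
    using h(1) agree by (auto intro: LIMSEQ_unique)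
qed

context
  fixes T :: "('a \<Rightarrow> 'b) \<Rightarrow> 'b" and C :: real
  assumes T_lincomb: "\<And>f g a b. f \<in> D \<Longrightarrow> g \<in> D \<Longrightarrow> T (\<lambda>x. a * f x + b * g x) = a * T f + b * T g"
    and T_bound: "\<And>f. f \<in> D \<Longrightarrow> norm (T f) \<le> C * p f" and C_nonneg: "C \<ge> 0"
begin

lemma norm_diff_le_of_dense:
  assumes h: "h \<in> D" and k: "k \<in> D" and f: "f \<in> E"
  shows "norm (T h - T k) \<le> C * (p (\<lambda>x. h x - f x) + p (\<lambda>x. k x - f x))"
proof -
  have hk: "h \<in> E" "k \<in> E"
    using h k dense_subset by auto
  have "norm (T h - T k) \<le> C * p (\<lambda>x. h x - k x)"
    using T_bound[OF dense_lincomb[OF h k, of 1 "- 1"]] T_lincomb[OF h k, of 1 "- 1"] by simp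
  also have "\<dots> \<le> C * (p (\<lambda>x. h x - f x) + p (\<lambda>x. k x - f x))"
    using seminorm_diff_triangle[OF hk(1) f hk(2)] seminorm_diff_commute[OF f hk(2)] C_nonneg
    by (intro mult_left_mono) auto
  finally show ?thesis .
qed

lemma convergent_of_dense_sequence:
  assumes f: "f \<in> E" and h: "\<And>n. h n \<in> D" "(\<lambda>n. p (\<lambda>x. h n x - f x)) \<longlonglongrightarrow> 0"
  shows "convergent (\<lambda>n. T (h n))"
proof (rule Cauchy_convergent, rule metric_CauchyI)
  fix e :: real assume "e > 0"
  have "(\<lambda>n. C * p (\<lambda>x. h n x - f x)) \<longlonglongrightarrow> 0"
    using tendsto_mult_right_zero[OF h(2)] .
  then have "\<forall>\<^sub>F n in sequentially. C * p (\<lambda>x. h n x - f x) < e / 2"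
    using \<open>e > 0\<close> by (intro order_tendstoD(2)) auto
  then obtain N where tail: "\<And>n. n \<ge> N \<Longrightarrow> C * p (\<lambda>x. h n x - f x) < e / 2"
    by (auto simp: eventually_sequentially)
  have "dist (T (h m)) (T (h n)) < e" if "m \<ge> N" "n \<ge> N" for m n
    using norm_diff_le_of_dense[OF h(1)[of m] h(1)[of n] f] tail[OF that(1)] tail[OF that(2)]
    by (simp add: dist_norm distrib_left)
  then show "\<exists>N. \<forall>m\<ge>N. \<forall>n\<ge>N. dist (T (h m)) (T (h n)) < e"
    by blast
qed

lemma dense_sequences_tendsto_0:
  assumes f: "f \<in> E" and h: "\<And>n. h n \<in> D" "(\<lambda>n. p (\<lambda>x. h n x - f x)) \<longlonglongrightarrow> 0"
    and k: "\<And>n. k n \<in> D" "(\<lambda>n. p (\<lambda>x. k n x - f x)) \<longlonglongrightarrow> 0"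
  shows "(\<lambda>n. T (h n) - T (k n)) \<longlonglongrightarrow> 0"
  by (rule Lim_null_comparison[OF always_eventually[OF allI[OF norm_diff_le_of_dense[OF h(1) k(1) f]]]
        tendsto_mult_right_zero[OF tendsto_add_zero[OF h(2) k(2)]]])

lemma norm_limit_le_of_dense_sequence:
  assumes f: "f \<in> E" and h: "\<And>n. h n \<in> D" "(\<lambda>n. p (\<lambda>x. h n x - f x)) \<longlonglongrightarrow> 0"
    and z: "(\<lambda>n. T (h n)) \<longlonglongrightarrow> z"
  shows "norm z \<le> C * p f"
proof (rule LIMSEQ_le)
  show "(\<lambda>n. norm (T (h n))) \<longlonglongrightarrow> norm z"
    by (rule tendsto_norm[OF z])
  show "(\<lambda>n. C * (p (\<lambda>x. h n x - f x) + p f)) \<longlonglongrightarrow> C * p f"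
    using tendsto_mult[OF tendsto_const tendsto_add[OF h(2) tendsto_const], of C "p f"] by simp
  have "h n \<in> E" for n
    using h(1) dense_subset by blast
  then have "norm (T (h n)) \<le> C * (p (\<lambda>x. h n x - f x) + p f)" for n
    by (intro order_trans[OF T_bound[OF h(1)] mult_left_mono[OF seminorm_le_diff[OF _ f] C_nonneg]])
  then show "\<exists>N. \<forall>n\<ge>N. norm (T (h n)) \<le> C * (p (\<lambda>x. h n x - f x) + p f)"
    by blast
qed

lemma bounded_functional_extension:
  obtains L where "L \<in> bounded_functionals E p" "\<And>f. f \<in> D \<Longrightarrow> L f = T f"
proof -
  have "\<forall>f\<in>E. \<exists>h. (\<forall>n. h n \<in> D) \<and> (\<lambda>n. p (\<lambda>x. h n x - f x)) \<longlonglongrightarrow> 0"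
    using dense_sequence by blast
  from bchoice[OF this] obtain S where SD: "\<And>f n. f \<in> E \<Longrightarrow> S f n \<in> D"
    and S_lim: "\<And>f. f \<in> E \<Longrightarrow> (\<lambda>n. p (\<lambda>x. S f n x - f x)) \<longlonglongrightarrow> 0"
    by blast
  have SE: "S f n \<in> E" if "f \<in> E" for f n
    using SD[OF that] dense_subset by blast
  define L where "L f = lim (\<lambda>n. T (S f n))" for f
  have T_LIMSEQ: "(\<lambda>n. T (S f n)) \<longlonglongrightarrow> L f" if "f \<in> E" for f
    using convergent_of_dense_sequence[OF that SD[OF that] S_lim[OF that]]
    by (simp add: L_def convergent_LIMSEQ_iff)
  have L_eqI: "L f = z" if "f \<in> E" "\<And>n. h n \<in> D" "(\<lambda>n. p (\<lambda>x. h n x - f x)) \<longlonglongrightarrow> 0"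
    "(\<lambda>n. T (h n)) \<longlonglongrightarrow> z" for f h z
    using dense_sequences_tendsto_0[OF that(1-3) SD[OF that(1)] S_lim[OF that(1)]] T_LIMSEQ[OF that(1)] that(4)
    by (metis LIMSEQ_unique Lim_transform2)
  have "L (\<lambda>x. a * f x + b * g x) = a * L f + b * L g" if f: "f \<in> E" and g: "g \<in> E" for f g a b
  proof (rule L_eqI[OF lincomb[OF f g] _
        seminorm_lincomb_tendsto_0[OF f SE[OF f] S_lim[OF f] g SE[OF g] S_lim[OF g]]])
    have "(\<lambda>n. a * T (S f n) + b * T (S g n)) \<longlonglongrightarrow> a * L f + b * L g"
      by (intro tendsto_intros T_LIMSEQ f g)
    then show "(\<lambda>n. T (\<lambda>x. a * S f n x + b * S g n x)) \<longlonglongrightarrow> a * L f + b * L g"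
      by (simp only: T_lincomb[OF SD[OF f] SD[OF g]])
  qed (intro dense_lincomb SD f g)
  moreover have "norm (L f) \<le> C * p f" if "f \<in> E" for f
    by (rule norm_limit_le_of_dense_sequence[OF that SD[OF that] S_lim[OF that] T_LIMSEQ[OF that]])
  ultimately have "L \<in> bounded_functionals E p"
    unfolding bounded_functionals_def by blast
  moreover have "L f = T f" if "f \<in> D" for f
  proof (rule L_eqI[of f "\<lambda>_. f"])
    show f: "f \<in> E"
      using that dense_subset by blast
    show "(\<lambda>_. p (\<lambda>x. f x - f x)) \<longlonglongrightarrow> 0"
      using seminorm_nonneg[OF diff_mem[OF f f]] seminorm_lincomb[OF f f, of 0 0] by simp
  qed (use that in auto)
  ultimately show thesis
    by (rule that)
qed

end

end

interpretation Xi: seminormed_functions "Xi k" "xi_norm k" for k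
  by unfold_locales (simp_all add: Xi_lincomb xi_norm_lincomb_le)

section \<open>Approximate identities\<close>

definition dilate :: "real \<Rightarrow> ('a::euclidean_space \<Rightarrow> 'b::real_vector) \<Rightarrow> 'a \<Rightarrow> 'b" where
  "dilate s G x = G (x /\<^sub>R s) /\<^sub>R s ^ DIM('a)"

lemma wconv_dilate:
  fixes G F :: "'a::euclidean_space \<Rightarrow> 'b::{real_normed_algebra, banach, second_countable_topology}"
  assumes "s > 0"
  shows "wconv lborel (dilate s G) F x = (\<integral>z. G z * F (x - s *\<^sub>R z) \<partial>lborel)"
  unfolding wconv_def using assms
  by (subst lborel_integral_affine[of s _ 0]) (simp_all add: dilate_def flip: integral_scaleR_right)

lemma uniform_limit_sequentiallyI:
  fixes f :: "nat \<Rightarrow> 'a \<Rightarrow> 'b::metric_space"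
  assumes "\<And>x. (\<lambda>n. dist (f n (x n)) (l (x n))) \<longlonglongrightarrow> 0"
  shows "uniform_limit UNIV f l sequentially"
proof (rule uniform_limitI)
  fix e :: real assume "e > 0"
  define x where "x n = (SOME z. dist (f n z) (l z) \<ge> e)" for n
  have x: "dist (f n (x n)) (l (x n)) \<ge> e" if "dist (f n z) (l z) \<ge> e" for n z
    unfolding x_def using that by (rule someI)
  have "\<forall>\<^sub>F n in sequentially. dist (f n (x n)) (l (x n)) < e"
    using assms \<open>e > 0\<close> by (rule order_tendstoD(2))
  then show "\<forall>\<^sub>F n in sequentially. \<forall>z\<in>UNIV. dist (f n z) (l z) < e"
    by eventually_elim (use x in \<open>force simp: not_less[symmetric]\<close>)
qed

lemma uniform_limit_wconv_dilate:
  fixes G F :: "'a::euclidean_space \<Rightarrow> 'b::{real_normed_algebra_1, banach, second_countable_topology}"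
  assumes G: "integrable lborel G" "(\<integral>z. G z \<partial>lborel) = 1" and F: "C0k 0 F"
    and \<sigma>: "\<And>n. \<sigma> n > 0" "\<sigma> \<longlonglongrightarrow> 0"
  shows "uniform_limit UNIV (\<lambda>n. wconv lborel (dilate (\<sigma> n) G) F) F sequentially"
proof (rule uniform_limit_sequentiallyI)
  fix x
  obtain B where F_bound: "\<And>x. norm (F x) \<le> B"
    using C0k_0_bounded[OF F] by blast
  let ?F = "\<lambda>n z. F (x n - \<sigma> n *\<^sub>R z)"
  have F_meas: "?F n \<in> borel_measurable lborel" for n
    using measurable_compose[OF _ C0k_0_borel_measurable[OF F], of "\<lambda>z. x n - \<sigma> n *\<^sub>R z" lborel] by simp
  have "(\<lambda>n. \<integral>z. G z * (?F n z - F (x n)) \<partial>lborel) \<longlonglongrightarrow> (\<integral>z. G z * 0 \<partial>lborel)"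
  proof (rule tendsto_integral_mult_bounded[OF G(1)])
    show "norm (?F n z - F (x n)) \<le> B + B" for n z
      by (rule order_trans[OF norm_triangle_ineq4 add_mono[OF F_bound F_bound]])
    have "(\<lambda>n. dist (x n - \<sigma> n *\<^sub>R z) (x n)) \<longlonglongrightarrow> 0" for z
      using tendsto_mult_left_zero[OF tendsto_rabs_zero[OF \<sigma>(2)], of "norm z"] by (simp add: dist_norm)
    with C0k_0_uniformly_continuous[OF F] have "(\<lambda>n. dist (?F n z) (F (x n))) \<longlonglongrightarrow> 0" for z
      unfolding uniformly_continuous_on_sequentially by simp
    then show "(\<lambda>n. ?F n z - F (x n)) \<longlonglongrightarrow> 0" for z
      by (simp add: dist_norm tendsto_norm_zero_iff)
  qed (use F_meas in measurable)
  moreover have "(\<integral>z. G z * (?F n z - F (x n)) \<partial>lborel) =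
      wconv lborel (dilate (\<sigma> n) G) F (x n) - F (x n)" for n
    using integrable_mult_bounded[OF G(1) F_meas F_bound] G \<sigma>(1) by (simp add: right_diff_distrib wconv_dilate)
  ultimately show "(\<lambda>n. dist (wconv lborel (dilate (\<sigma> n) G) F (x n)) (F (x n))) \<longlonglongrightarrow> 0"
    by (simp add: dist_norm tendsto_norm_zero_iff)
qed

lemma cgauss_eq_dilate: "s > 0 \<Longrightarrow> cgauss s = dilate s (cgauss 1)"
  by (auto simp: gauss_def dilate_def scaleR_conv_of_real power_mult_distrib field_simps)

section \<open>Gaussian mollification\<close>

definition mollify :: "real \<Rightarrow> ('a::euclidean_space \<Rightarrow> complex) \<Rightarrow> 'a \<Rightarrow> complex" where
  "mollify s = wconv lborel (cgauss s)"

lemma mollify_eq_wconv: "mollify s f = wconv lborel f (cgauss s)"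
  unfolding mollify_def by (rule wconv_commute)

lemma C0k_0_gauss: "s > 0 \<Longrightarrow> C0k 0 (cgauss s)"
  using schwartz_gauss by (rule schwartz_imp_C0k)

lemma Xi_mollify: "f \<in> Xi k \<Longrightarrow> s > 0 \<Longrightarrow> mollify s f \<in> Xi k"
  unfolding mollify_def by (intro Xi_wconv sigma_finite_lborel integrable_gauss) auto

lemma
  fixes f :: "'a::euclidean_space \<Rightarrow> complex"
  assumes f: "integrable lborel f" and s: "s > 0"
  shows Xi_mollify_integrable: "mollify s f \<in> Xi k"
    and xi_norm_mollify_le_L1: "xi_norm k (mollify s f) \<le>
      (\<integral>x. norm (f x) \<partial>lborel) * xi_norm k (cgauss s :: 'a \<Rightarrow> complex)"
  unfolding mollify_eq_wconv using schwartz_imp_Xi[OF schwartz_gauss[OF s]]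
  by (auto intro!: Xi_wconv xi_norm_wconv_le sigma_finite_lborel f)

lemma mollify_diff:
  fixes f g :: "'a::euclidean_space \<Rightarrow> complex"
  assumes f: "integrable lborel f" and g: "integrable lborel g" and s: "s > 0"
  shows "mollify s (\<lambda>x. f x - g x) = (\<lambda>x. mollify s f x - mollify s g x)"
proof
  fix x
  obtain B where gauss_bound: "\<And>x :: 'a. norm (cgauss s x) \<le> B"
    using C0k_0_bounded[OF C0k_0_gauss[OF s]] by blast
  have "integrable lborel (\<lambda>z. f z * cgauss s (x - z))" "integrable lborel (\<lambda>z. g z * cgauss s (x - z))"
    using f g by (auto intro!: wconv_integrable[OF _ _ _ gauss_bound])
  then show "mollify s (\<lambda>x. f x - g x) x = mollify s f x - mollify s g x"
    by (simp add: mollify_eq_wconv wconv_def left_diff_distrib)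
qed

lemma ft_mollify:
  assumes "integrable lborel f" "s > 0"
  shows "ft (mollify s f) \<omega> = cgauss_ft s \<omega> * ft f \<omega>"
proof -
  have "ft (mollify s f) \<omega> = (\<integral>z. cgauss s z * cis (\<omega> \<bullet> z) \<partial>lborel) * ft f \<omega>"
    unfolding mollify_def using assms by (intro ft_wconv sigma_finite_lborel integrable_gauss) auto
  then show ?thesis
    using ft_gauss[OF assms(2), of \<omega>] by (simp add: ft_def mult.commute)
qed

lemma ft_ft_mult_gauss_ft:
  fixes f :: "'a::euclidean_space \<Rightarrow> complex"
  assumes f: "integrable lborel f" and s: "s > 0"
  shows "ft (\<lambda>\<omega>. ft f \<omega> * cgauss_ft s \<omega>) (- z) = complex_of_real ((2 * pi) ^ DIM('a)) * mollify s f z"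
proof -
  have "ft (\<lambda>\<omega>. ft f \<omega> * cgauss_ft s \<omega>) (- z) =
      wconv lborel f (\<lambda>x. complex_of_real ((2 * pi) ^ DIM('a)) * cgauss s x) z"
    unfolding ft_ft_mult[OF f integrable_gauss_ft[OF s]] by (simp add: ft_gauss_ft[OF s])
  then show ?thesis
    unfolding mollify_eq_wconv wconv_def integral_mult_right_zero[symmetric]
    by (simp only: mult.left_commute)
qed

lemma uniform_limit_mollify:
  assumes "C0k 0 f" "\<And>n. \<sigma> n > 0" "\<sigma> \<longlonglongrightarrow> 0"
  shows "uniform_limit UNIV (\<lambda>n. mollify (\<sigma> n) f) f sequentially"
  using uniform_limit_wconv_dilate[OF integrable_gauss[of 1] _ assms] assms(2)
  by (simp add: mollify_def integral_gauss flip: cgauss_eq_dilate)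

lemma mollify_LIMSEQ:
  assumes "C0k 0 f" "\<And>n. \<sigma> n > 0" "\<sigma> \<longlonglongrightarrow> 0"
  shows "(\<lambda>n. mollify (\<sigma> n) f x) \<longlonglongrightarrow> f x"
  using uniform_limit_mollify[OF assms] by (rule tendsto_uniform_limitI) simp

lemma integral_mollify_diff_LIMSEQ:
  assumes f: "f \<in> Xi 0" and \<sigma>: "\<And>n. \<sigma> n > 0" "\<sigma> \<longlonglongrightarrow> 0"
  shows "(\<lambda>n. \<integral>x. norm (mollify (\<sigma> n) f x - f x) \<partial>lborel) \<longlonglongrightarrow> 0"
proof -
  have f_int: "integrable lborel f" and m_int: "integrable lborel (mollify (\<sigma> n) f)" for n
    using Xi_integrable[OF f] Xi_integrable[OF Xi_mollify[OF f \<sigma>(1)]] by auto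
  have "(\<lambda>n. \<integral>\<^sup>+ x. norm (mollify (\<sigma> n) f x - f x) \<partial>lborel) \<longlonglongrightarrow> 0"
  proof (rule Scheffe_lemma2)
    show "mollify (\<sigma> n) f \<in> borel_measurable lborel" for n
      using m_int by auto
    show "AE x in lborel. (\<lambda>n. mollify (\<sigma> n) f x) \<longlonglongrightarrow> f x"
      by (intro AE_I2 mollify_LIMSEQ Xi_imp_C0k f \<sigma>)
    have "(\<integral>x. norm (mollify (\<sigma> n) f x) \<partial>lborel) \<le> (\<integral>x. norm (f x) \<partial>lborel)" for n
      using integral_norm_wconv_le[OF sigma_finite_lborel _ integrable_gauss[OF \<sigma>(1)] f_int]
      using \<sigma>(1) by (simp add: mollify_def integral_gauss)
    then show "(\<integral>\<^sup>+ x. norm (mollify (\<sigma> n) f x) \<partial>lborel) \<le> (\<integral>\<^sup>+ x. norm (f x) \<partial>lborel)" for n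
      using f_int m_int by (simp add: nn_integral_eq_integral ennreal_leI)
  qed (rule f_int)
  then have "(\<lambda>n. ennreal (\<integral>x. norm (mollify (\<sigma> n) f x - f x) \<partial>lborel)) \<longlonglongrightarrow> ennreal 0"
    using f_int m_int by (simp add: nn_integral_eq_integral)
  then show ?thesis
    by (subst (asm) tendsto_ennreal_iff) auto
qed

lemma Ck_norm_mollify_diff_LIMSEQ:
  assumes f: "C0k k f" and \<sigma>: "\<And>n. \<sigma> n > 0" "\<sigma> \<longlonglongrightarrow> 0"
  shows "(\<lambda>n. Ck_norm k (\<lambda>x. mollify (\<sigma> n) f x - f x)) \<longlonglongrightarrow> 0"
proof (rule tendstoI)
  fix e :: real assume "e > 0"
  have m: "C0k k (mollify (\<sigma> n) f)" for n
    unfolding mollify_def by (intro C0k_wconv integrable_gauss \<sigma> f) simp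
  have pds: "pds bs (\<lambda>x. mollify (\<sigma> n) f x - f x) = (\<lambda>x. mollify (\<sigma> n) (pds bs f) x - pds bs f x)"
    if "bs \<in> multi_idx k" for bs n
    using pds_lincomb[OF C0k_imp_Ck[OF m] C0k_imp_Ck[OF f] that, where a = 1 and b = "- 1"] that
    by (simp add: mollify_def pds_wconv[OF _ integrable_gauss[OF \<sigma>(1)] f])
  have "\<forall>\<^sub>F n in sequentially. \<forall>bs\<in>multi_idx k. \<forall>x. dist (mollify (\<sigma> n) (pds bs f) x) (pds bs f x) < e / 2"
  proof (intro eventually_ball_finite ballI)
    fix bs :: "'a list" assume "bs \<in> multi_idx k"
    then have "C0k 0 (pds bs f)"
      using f by (simp add: C0k_iff[of k])
    from uniform_limitD[OF uniform_limit_mollify[OF this \<sigma>], of "e / 2"] \<open>e > 0\<close>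
    show "\<forall>\<^sub>F n in sequentially. \<forall>x. dist (mollify (\<sigma> n) (pds bs f) x) (pds bs f x) < e / 2"
      by simp
  qed simp
  then show "\<forall>\<^sub>F n in sequentially. dist (Ck_norm k (\<lambda>x. mollify (\<sigma> n) f x - f x)) 0 < e"
  proof eventually_elim
    case (elim n)
    then have "Ck_norm k (\<lambda>x. mollify (\<sigma> n) f x - f x) \<le> e / 2"
      using pds by (intro Ck_norm_le) (auto simp: dist_norm intro: less_imp_le)
    moreover have "0 \<le> Ck_norm k (\<lambda>x. mollify (\<sigma> n) f x - f x)"
      using C0k_lincomb[OF m f, where a = 1 and b = "- 1"] by (intro Ck_norm_nonneg) simp
    ultimately show ?case
      using \<open>e > 0\<close> by simp
  qed
qed

lemma xi_norm_mollify_diff_LIMSEQ: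
  assumes f: "f \<in> Xi k" and \<sigma>: "\<And>n. \<sigma> n > 0" "\<sigma> \<longlonglongrightarrow> 0"
  shows "(\<lambda>n. xi_norm k (\<lambda>x. mollify (\<sigma> n) f x - f x)) \<longlonglongrightarrow> 0"
proof -
  have "f \<in> Xi 0"
    using f C0k_imp_C0k_0 by (auto simp: Xi_def)
  then show ?thesis
    unfolding xi_norm_eq
    using Ck_norm_mollify_diff_LIMSEQ[OF Xi_imp_C0k[OF f] \<sigma>] integral_mollify_diff_LIMSEQ[OF _ \<sigma>]
    by (intro tendsto_add_zero)
qed

section \<open>Density of the Schwartz functions\<close>

definition truncate_ball :: "nat \<Rightarrow> ('a::real_normed_vector \<Rightarrow> 'b::real_vector) \<Rightarrow> 'a \<Rightarrow> 'b" where
  "truncate_ball n f x = indicator (cball 0 (real n)) x *\<^sub>R f x"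

lemma integrable_truncate_ball:
  fixes f :: "'a::euclidean_space \<Rightarrow> 'b::{banach, second_countable_topology}"
  assumes f: "integrable lborel f"
  shows "integrable lborel (truncate_ball n f)"
  unfolding truncate_ball_def using f by (intro integrable_mult_indicator) auto

lemma integrable_moment_truncate_ball:
  fixes f :: "'a::euclidean_space \<Rightarrow> 'b::{banach, second_countable_topology}"
  assumes f: "integrable lborel f"
  shows "integrable lborel (\<lambda>x. (1 + norm x) ^ m *\<^sub>R truncate_ball n f x)"
proof (rule integrable_dominated)
  show "integrable lborel (\<lambda>x. (1 + real n) ^ m * norm (f x))"
    using f by simp
  show "(\<lambda>x. (1 + norm x) ^ m *\<^sub>R truncate_ball n f x) \<in> borel_measurable lborel"
    using integrable_truncate_ball[OF f, of n] by auto
  show "norm ((1 + norm x) ^ m *\<^sub>R truncate_ball n f x) \<le> (1 + real n) ^ m * norm (f x)" for x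
    by (auto simp: truncate_ball_def indicator_def intro!: mult_right_mono power_mono)
qed

lemma integral_truncate_ball_diff_LIMSEQ:
  fixes f :: "'a::euclidean_space \<Rightarrow> 'b::{banach, second_countable_topology}"
  assumes f: "integrable lborel f"
  shows "(\<lambda>n. \<integral>x. norm (truncate_ball n f x - f x) \<partial>lborel) \<longlonglongrightarrow> 0"
proof -
  let ?outside = "\<lambda>n. indicator (- cball 0 (real n)) :: 'a \<Rightarrow> real"
  have "(\<lambda>n. \<integral>x. norm (f x) * ?outside n x \<partial>lborel) \<longlonglongrightarrow> (\<integral>x. norm (f x) * 0 \<partial>lborel)"
  proof (rule tendsto_integral_mult_bounded[where B = 1])
    show "(\<lambda>n. ?outside n x) \<longlonglongrightarrow> 0" for x
    proof (rule tendsto_eventually)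
      obtain m :: nat where "norm x \<le> real m"
        using real_arch_simple by blast
      then show "\<forall>\<^sub>F n in sequentially. ?outside n x = 0"
        by (intro eventually_sequentiallyI[of m]) (simp add: indicator_def)
    qed
  qed (use f in \<open>auto simp: indicator_def\<close>)
  moreover have "norm (truncate_ball n f x - f x) = norm (f x) * ?outside n x" for n x
    by (simp add: truncate_ball_def indicator_def)
  ultimately show ?thesis
    by simp
qed

lemma schwartz_mollify_truncate_ball:
  assumes "integrable lborel f" "s > 0"
  shows "schwartz (mollify s (truncate_ball n f))"
  unfolding mollify_eq_wconv
  using assms by (intro schwartz_wconv integrable_moment_truncate_ball schwartz_gauss) auto

lemma xi_norm_mollify_truncate_ball_LIMSEQ:
  fixes f :: "'a::euclidean_space \<Rightarrow> complex"
  assumes f: "integrable lborel f" and s: "s > 0"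
  shows "(\<lambda>n. xi_norm k (\<lambda>x. mollify s (truncate_ball n f) x - mollify s f x)) \<longlonglongrightarrow> 0"
proof -
  let ?d = "\<lambda>n x. truncate_ball n f x - f x"
  have d_int: "integrable lborel (?d n)" for n
    using integrable_truncate_ball[OF f] f by simp
  have "(\<lambda>n. xi_norm k (mollify s (?d n))) \<longlonglongrightarrow> 0"
  proof (rule tendsto_sandwich[OF _ _ tendsto_const])
    show "\<forall>\<^sub>F n in sequentially. 0 \<le> xi_norm k (mollify s (?d n))"
      by (intro always_eventually allI Xi.seminorm_nonneg Xi_mollify_integrable d_int s)
    show "\<forall>\<^sub>F n in sequentially. xi_norm k (mollify s (?d n)) \<le>
        (\<integral>x. norm (?d n x) \<partial>lborel) * xi_norm k (cgauss s :: 'a \<Rightarrow> complex)"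
      by (intro always_eventually allI xi_norm_mollify_le_L1 d_int s)
    show "(\<lambda>n. (\<integral>x. norm (?d n x) \<partial>lborel) * xi_norm k (cgauss s :: 'a \<Rightarrow> complex)) \<longlonglongrightarrow> 0"
      by (intro tendsto_mult_left_zero integral_truncate_ball_diff_LIMSEQ f)
  qed
  then show ?thesis
    by (simp add: mollify_diff[OF integrable_truncate_ball[OF f] f s])
qed

lemma schwartz_dense_Xi:
  fixes f :: "'a::euclidean_space \<Rightarrow> complex"
  assumes f: "f \<in> Xi k" and "e > 0"
  obtains h where "schwartz h" "xi_norm k (\<lambda>x. h x - f x) < e"
proof -
  have "\<forall>\<^sub>F n in sequentially. xi_norm k (\<lambda>x. mollify (inverse (real (Suc n))) f x - f x) < e / 2"
    using xi_norm_mollify_diff_LIMSEQ[OF f _ LIMSEQ_inverse_real_of_nat] \<open>e > 0\<close>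
    by (intro order_tendstoD(2)) auto
  then obtain s where s: "s > 0" "xi_norm k (\<lambda>x. mollify s f x - f x) < e / 2"
    unfolding eventually_sequentially
    by (metis inverse_positive_iff_positive of_nat_0_less_iff order_refl zero_less_Suc)
  let ?h = "\<lambda>m. mollify s (truncate_ball m f)"
  have h: "schwartz (?h m)" for m
    by (rule schwartz_mollify_truncate_ball[OF Xi_integrable[OF f] s(1)])
  have "\<forall>\<^sub>F m in sequentially. xi_norm k (\<lambda>x. ?h m x - mollify s f x) < e / 2"
    using xi_norm_mollify_truncate_ball_LIMSEQ[OF Xi_integrable[OF f] s(1), of k] \<open>e > 0\<close>
    by (intro order_tendstoD(2)) auto
  then obtain m where "xi_norm k (\<lambda>x. ?h m x - mollify s f x) < e / 2"
    by (auto simp: eventually_sequentially)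
  then have "xi_norm k (\<lambda>x. ?h m x - f x) < e"
    using Xi.seminorm_diff_triangle[OF schwartz_imp_Xi[OF h] Xi_mollify[OF f s(1)] f, of m] s(2) by simp
  then show thesis
    using h by (rule that[rotated])
qed

interpretation Xi: dense_functions "Xi k" "Collect schwartz" "xi_norm k" for k
proof
  show "\<exists>h\<in>Collect schwartz. xi_norm k (\<lambda>x. h x - f x) < e"
    if "f \<in> Xi k" "e > 0" for f :: "'a \<Rightarrow> complex" and e
    using schwartz_dense_Xi[OF that] by blast
qed (auto simp: schwartz_imp_Xi schwartz_lincomb)

section \<open>Inverse Fourier transforms of tempered functions\<close>

definition tempered :: "('a::euclidean_space \<Rightarrow> complex) \<Rightarrow> bool" where
  "tempered Q \<longleftrightarrow> Q \<in> borel_measurable borel \<and>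
     (\<exists>N::nat. integrable lborel (\<lambda>\<omega>. norm (Q \<omega>) / (1 + norm \<omega>) ^ N))"

lemma tempered_mult_rapidly_decreasing:
  fixes Q h :: "'a::euclidean_space \<Rightarrow> complex"
  assumes Q: "tempered Q" and h: "h \<in> borel_measurable borel" "rapidly_decreasing h"
  shows "integrable lborel (\<lambda>\<omega>. Q \<omega> * h \<omega>)"
proof -
  obtain N :: nat where Q_int: "integrable lborel (\<lambda>\<omega>. norm (Q \<omega>) / (1 + norm \<omega>) ^ N)"
    using Q by (auto simp: tempered_def)
  obtain B where h_bound: "\<And>\<omega>. (1 + norm \<omega>) ^ N * norm (h \<omega>) \<le> B"
    using h(2) by (rule rapidly_decreasingE) blast
  show ?thesis
  proof (rule integrable_dominated)
    show "integrable lborel (\<lambda>\<omega>. norm (Q \<omega>) / (1 + norm \<omega>) ^ N * B)"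
      using Q_int by (rule integrable_mult_left)
    show "(\<lambda>\<omega>. Q \<omega> * h \<omega>) \<in> borel_measurable lborel"
      using Q h(1) unfolding tempered_def by auto
    fix \<omega> :: 'a
    have "1 + norm \<omega> \<noteq> 0"
      using norm_ge_zero[of \<omega>] by linarith
    then have "norm (Q \<omega> * h \<omega>) = norm (Q \<omega>) / (1 + norm \<omega>) ^ N * ((1 + norm \<omega>) ^ N * norm (h \<omega>))"
      by (simp add: norm_mult)
    also have "\<dots> \<le> norm (Q \<omega>) / (1 + norm \<omega>) ^ N * B"
      using h_bound by (intro mult_left_mono) auto
    finally show "norm (Q \<omega> * h \<omega>) \<le> norm (Q \<omega>) / (1 + norm \<omega>) ^ N * B" .
  qed
qed

lemma tempered_mult_ft_schwartz:
  assumes Q: "tempered Q" and f: "schwartz f"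
  shows "integrable lborel (\<lambda>\<omega>. Q \<omega> * ft f (- \<omega>))"
proof (rule tempered_mult_rapidly_decreasing[OF Q])
  have [measurable]: "f \<in> borel_measurable borel"
    by (intro C0k_0_borel_measurable schwartz_imp_C0k f)
  show "(\<lambda>\<omega>. ft f (- \<omega>)) \<in> borel_measurable borel"
    by measurable
  show "rapidly_decreasing (\<lambda>\<omega>. ft f (- \<omega>))"
    using rapidly_decreasing_ft[OF f] unfolding rapidly_decreasing_def by (metis norm_minus_cancel)
qed

lemma inv_ft_reg_distr_eq:
  "inv_ft_reg_distr Q f = complex_of_real (1 / (2 * pi) ^ DIM('a)) * (\<integral>\<omega>. Q \<omega> * ft f (- \<omega>) \<partial>lborel)"
  for f :: "'a::euclidean_space \<Rightarrow> complex"
  unfolding inv_ft_reg_distr_def ift_eq_ft integral_mult_right_zero[symmetric]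
  by (simp only: mult.left_commute)

lemma inv_ft_reg_distr_lincomb:
  assumes f: "integrable lborel f" "integrable lborel (\<lambda>\<omega>. Q \<omega> * ft f (- \<omega>))"
    and g: "integrable lborel g" "integrable lborel (\<lambda>\<omega>. Q \<omega> * ft g (- \<omega>))"
  shows "inv_ft_reg_distr Q (\<lambda>x. a * f x + b * g x) = a * inv_ft_reg_distr Q f + b * inv_ft_reg_distr Q g"
proof -
  have "(\<integral>\<omega>. Q \<omega> * ft (\<lambda>x. a * f x + b * g x) (- \<omega>) \<partial>lborel) =
      (\<integral>\<omega>. a * (Q \<omega> * ft f (- \<omega>)) + b * (Q \<omega> * ft g (- \<omega>)) \<partial>lborel)"
    by (simp add: ft_lincomb[OF f(1) g(1)] algebra_simps)
  then show ?thesis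
    using f(2) g(2) by (simp add: inv_ft_reg_distr_eq algebra_simps)
qed

context
  fixes Q :: "'a::euclidean_space \<Rightarrow> complex" and s :: real
  assumes Q: "tempered Q" and s: "s > 0"
begin

lemma tempered_mult_gauss_ft: "integrable lborel (\<lambda>\<omega>. Q \<omega> * cgauss_ft s \<omega>)"
  by (intro tempered_mult_rapidly_decreasing Q rapidly_decreasing_gauss_ft s) measurable

lemma
  assumes f: "integrable lborel f"
  shows tempered_mult_ft_mollify: "integrable lborel (\<lambda>\<omega>. Q \<omega> * ft (mollify s f) (- \<omega>))"
    and norm_inv_ft_reg_distr_mollify_le: "norm (inv_ft_reg_distr Q (mollify s f)) \<le>
      1 / (2 * pi) ^ DIM('a) * (\<integral>\<omega>. norm (Q \<omega> * cgauss_ft s \<omega>) \<partial>lborel) * (\<integral>x. norm (f x) \<partial>lborel)"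
proof -
  have [measurable]: "f \<in> borel_measurable borel"
    using f borel_measurable_integrable by auto
  have Q_ft: "Q \<omega> * ft (mollify s f) (- \<omega>) = Q \<omega> * cgauss_ft s \<omega> * ft f (- \<omega>)" for \<omega>
    by (simp add: ft_mollify[OF f s])
  show "integrable lborel (\<lambda>\<omega>. Q \<omega> * ft (mollify s f) (- \<omega>))"
    unfolding Q_ft by (rule integrable_mult_bounded[OF tempered_mult_gauss_ft _ norm_ft_le]) measurable
  have "norm (\<integral>\<omega>. Q \<omega> * cgauss_ft s \<omega> * ft f (- \<omega>) \<partial>lborel) \<le>
      (\<integral>\<omega>. norm (Q \<omega> * cgauss_ft s \<omega>) \<partial>lborel) * (\<integral>x. norm (f x) \<partial>lborel)"
    by (rule norm_integral_mult_bounded_le[OF tempered_mult_gauss_ft _ norm_ft_le]) measurable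
  moreover have "norm (inv_ft_reg_distr Q (mollify s f)) =
      1 / (2 * pi) ^ DIM('a) * norm (\<integral>\<omega>. Q \<omega> * cgauss_ft s \<omega> * ft f (- \<omega>) \<partial>lborel)"
    by (simp add: inv_ft_reg_distr_eq Q_ft norm_mult norm_divide norm_power)
  ultimately show "norm (inv_ft_reg_distr Q (mollify s f)) \<le>
      1 / (2 * pi) ^ DIM('a) * (\<integral>\<omega>. norm (Q \<omega> * cgauss_ft s \<omega>) \<partial>lborel) * (\<integral>x. norm (f x) \<partial>lborel)"
    by (simp add: divide_right_mono)
qed

lemma inv_ft_reg_distr_mollify_truncate_ball_LIMSEQ:
  assumes f: "integrable lborel f"
  shows "(\<lambda>n. inv_ft_reg_distr Q (mollify s (truncate_ball n f))) \<longlonglongrightarrow> inv_ft_reg_distr Q (mollify s f)"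
proof -
  let ?d = "\<lambda>n x. truncate_ball n f x - f x"
    and ?K = "1 / (2 * pi) ^ DIM('a) * (\<integral>\<omega>. norm (Q \<omega> * cgauss_ft s \<omega>) \<partial>lborel)"
  note trunc = integrable_truncate_ball[OF f]
  have "inv_ft_reg_distr Q (mollify s (?d n)) =
      inv_ft_reg_distr Q (mollify s (truncate_ball n f)) - inv_ft_reg_distr Q (mollify s f)" for n
    using inv_ft_reg_distr_lincomb[of "mollify s (truncate_ball n f)" Q "mollify s f" 1 "- 1"]
    by (simp add: mollify_diff f trunc s tempered_mult_ft_mollify Xi_integrable[OF Xi_mollify_integrable])
  moreover have bound: "norm (inv_ft_reg_distr Q (mollify s (?d n))) \<le> ?K * (\<integral>x. norm (?d n x) \<partial>lborel)" for n
    using trunc f by (intro norm_inv_ft_reg_distr_mollify_le) simp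
  moreover have "(\<lambda>n. inv_ft_reg_distr Q (mollify s (?d n))) \<longlonglongrightarrow> 0"
    by (rule Lim_null_comparison[OF always_eventually[OF allI[OF bound]]
          tendsto_mult_right_zero[OF integral_truncate_ball_diff_LIMSEQ[OF f]]])
  ultimately show ?thesis
    by (simp add: LIM_zero_iff)
qed

end

section \<open>Extension to \<open>\<Xi>\<^sup>k\<close>\<close>

definition Xi_extension ::
    "nat \<Rightarrow> (('a::euclidean_space \<Rightarrow> complex) \<Rightarrow> complex) \<Rightarrow> (('a \<Rightarrow> complex) \<Rightarrow> complex) \<Rightarrow> bool" where
  "Xi_extension k T L \<longleftrightarrow>
     (\<forall>\<psi>\<in>Xi k. \<forall>\<phi>\<in>Xi k. \<forall>a b. L (\<lambda>x. a * \<psi> x + b * \<phi> x) = a * L \<psi> + b * L \<phi>) \<and>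
     (\<exists>C. \<forall>\<psi>\<in>Xi k. norm (L \<psi>) \<le> C * xi_norm k \<psi>) \<and> (\<forall>\<psi>. schwartz \<psi> \<longrightarrow> L \<psi> = T \<psi>)"

lemma Xi_extension_iff:
  "Xi_extension k T L \<longleftrightarrow>
     L \<in> bounded_functionals (Xi k) (xi_norm k) \<and> (\<forall>\<psi>. schwartz \<psi> \<longrightarrow> L \<psi> = T \<psi>)"
  by (simp add: Xi_extension_def bounded_functionals_def)

lemma Xi_extension_schwartz: "Xi_extension k T L \<Longrightarrow> schwartz \<psi> \<Longrightarrow> L \<psi> = T \<psi>"
  by (simp add: Xi_extension_def)

lemma Xi_extension_unique:
  assumes "Xi_extension k T L" "Xi_extension k T L'" "\<psi> \<in> Xi k"
  shows "L \<psi> = L' \<psi>"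
  by (rule Xi.bounded_functionals_eqI[of L k L']) (use assms in \<open>auto simp: Xi_extension_iff\<close>)

lemma Xi_extension_tendsto:
  assumes "Xi_extension k T L" "f \<in> Xi k" "\<And>n. fs n \<in> Xi k" "(\<lambda>n. xi_norm k (\<lambda>x. fs n x - f x)) \<longlonglongrightarrow> 0"
  shows "(\<lambda>n. L (fs n)) \<longlonglongrightarrow> L f"
  by (rule Xi.bounded_functionals_tendsto[OF conjunct1[OF assms(1)[unfolded Xi_extension_iff]] assms(2-4)])

lemma Xi_extension_LIMSEQ_schwartz:
  assumes L: "Xi_extension k T L" and f: "f \<in> Xi k" and fs: "\<And>n. schwartz (fs n)"
    and lim: "(\<lambda>n. xi_norm k (\<lambda>x. fs n x - f x)) \<longlonglongrightarrow> 0"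
  shows "(\<lambda>n. T (fs n)) \<longlonglongrightarrow> L f"
  using Xi_extension_tendsto[OF L f schwartz_imp_Xi[OF fs] lim] by (simp add: Xi_extension_schwartz[OF L fs])

lemma Xi_extension_exists:
  assumes Q: "tempered Q"
    and bound: "\<And>\<psi>. schwartz \<psi> \<Longrightarrow> norm (inv_ft_reg_distr Q \<psi>) \<le> C * xi_norm k \<psi>" and "C \<ge> 0"
  obtains L where "Xi_extension k (inv_ft_reg_distr Q) L"
proof (rule Xi.bounded_functional_extension)
  show "inv_ft_reg_distr Q (\<lambda>x. a * f x + b * g x) = a * inv_ft_reg_distr Q f + b * inv_ft_reg_distr Q g"
    if "f \<in> Collect schwartz" "g \<in> Collect schwartz" for f g a b
    using that
    by (intro inv_ft_reg_distr_lincomb tempered_mult_ft_schwartz Q Xi_integrable[OF schwartz_imp_Xi]) auto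
  show "norm (inv_ft_reg_distr Q f) \<le> C * xi_norm k f" if "f \<in> Collect schwartz" for f
    using that by (simp add: bound)
qed (use \<open>C \<ge> 0\<close> that in \<open>auto simp: Xi_extension_iff\<close>)

context
  fixes Q :: "'a::euclidean_space \<Rightarrow> complex" and k :: nat and L
  assumes Q: "tempered Q" and L: "Xi_extension k (inv_ft_reg_distr Q) L"
begin

lemma Xi_extension_mollify:
  assumes f: "integrable lborel f" and s: "s > 0"
  shows "L (mollify s f) = inv_ft_reg_distr Q (mollify s f)"
proof (rule LIMSEQ_unique)
  show "(\<lambda>n. inv_ft_reg_distr Q (mollify s (truncate_ball n f))) \<longlonglongrightarrow> L (mollify s f)"
    by (intro Xi_extension_LIMSEQ_schwartz[OF L] Xi_mollify_integrable schwartz_mollify_truncate_ball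
        xi_norm_mollify_truncate_ball_LIMSEQ f s)
  show "(\<lambda>n. inv_ft_reg_distr Q (mollify s (truncate_ball n f))) \<longlonglongrightarrow> inv_ft_reg_distr Q (mollify s f)"
    by (rule inv_ft_reg_distr_mollify_truncate_ball_LIMSEQ[OF Q s f])
qed

lemma Xi_extension_eq_lim_mollify:
  assumes f: "f \<in> Xi k" and \<sigma>: "\<And>n. \<sigma> n > 0" "\<sigma> \<longlonglongrightarrow> 0"
  shows "(\<lambda>n. inv_ft_reg_distr Q (mollify (\<sigma> n) f)) \<longlonglongrightarrow> L f"
  unfolding Xi_extension_mollify[OF Xi_integrable[OF f] \<sigma>(1), symmetric]
  by (intro Xi_extension_tendsto[OF L f] Xi_mollify xi_norm_mollify_diff_LIMSEQ f \<sigma>)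

end

section \<open>The Tweedie functional\<close>

lemma fin_borelD:
  assumes "fin_borel \<mu>"
  shows "sigma_finite_measure \<mu>" "sets \<mu> = sets borel" "integrable \<mu> (\<lambda>_. c :: complex)"
proof -
  interpret finite_measure \<mu>
    using assms by (simp add: fin_borel_def)
  show "sigma_finite_measure \<mu>" "integrable \<mu> (\<lambda>_. c)"
    by unfold_locales simp
  show "sets \<mu> = sets borel"
    using assms by (simp add: fin_borel_def)
qed

lemma Xi_wconv_fin_borel: "fin_borel \<mu> \<Longrightarrow> F \<in> Xi k \<Longrightarrow> wconv \<mu> (\<lambda>_. 1) F \<in> Xi k"
  by (intro Xi_wconv fin_borelD)

lemma integral_ft_fin_borel:
  fixes h :: "'a::euclidean_space \<Rightarrow> complex"
  assumes \<mu>: "fin_borel \<mu>" and h: "integrable lborel h"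
  shows "(\<integral>z. ft h (- z) \<partial>\<mu>) = (\<integral>\<omega>. h \<omega> * (\<integral>z. cis (- (z \<bullet> \<omega>)) \<partial>\<mu>) \<partial>lborel)"
proof -
  note [measurable_cong] = fin_borelD(2)[OF \<mu>]
  have "(\<integral>z. 1 * (\<integral>\<omega>. cis (- (z \<bullet> \<omega>)) * h \<omega> \<partial>lborel) \<partial>\<mu>) =
      (\<integral>\<omega>. h \<omega> * (\<integral>z. cis (- (z \<bullet> \<omega>)) * 1 \<partial>\<mu>) \<partial>lborel)"
    by (rule integral_bounded_kernel_swap[where K = 1])
      (use h in \<open>auto intro!: pair_sigma_finite.intro sigma_finite_lborel fin_borelD[OF \<mu>]\<close>)
  then show ?thesis
    by (simp add: ft_def)
qed

lemma inv_ft_reg_distr_mollify_wconv: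
  fixes F lam :: "'a::euclidean_space \<Rightarrow> complex"
  assumes \<mu>: "fin_borel \<mu>" and F: "integrable lborel F" and lam: "integrable lborel lam"
    and Q: "Q \<in> borel_measurable borel" "AE \<omega> in lborel. Q \<omega> * ft F (- \<omega>) = ft lam \<omega>" and s: "s > 0"
  shows "inv_ft_reg_distr Q (mollify s (wconv \<mu> (\<lambda>_. 1) F)) = (\<integral>z. mollify s lam z \<partial>\<mu>)"
proof -
  note \<mu>' = fin_borelD[OF \<mu>]
  note [measurable_cong] = \<mu>'(2)
  let ?f = "wconv \<mu> (\<lambda>_. 1) F" and ?\<mu>_hat = "\<lambda>\<omega>. \<integral>z. cis (- (z \<bullet> \<omega>)) \<partial>\<mu>"
    and ?h = "\<lambda>\<omega>. ft lam \<omega> * cgauss_ft s \<omega>"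
  have [measurable]: "F \<in> borel_measurable borel" "lam \<in> borel_measurable borel"
    using F lam borel_measurable_integrable by auto
  have f: "integrable lborel ?f"
    by (intro integrable_wconv \<mu>' F)
  have h: "integrable lborel ?h"
    using integrable_mult_bounded[OF integrable_gauss_ft[OF s] _ norm_ft_le, of lam "\<lambda>\<omega>. \<omega>"]
    by (simp add: mult.commute)
  have ft_f: "ft ?f (- \<omega>) = ?\<mu>_hat \<omega> * ft F (- \<omega>)" for \<omega>
    using ft_wconv[OF \<mu>' F, of 1 "- \<omega>"] by (simp add: inner_commute)
  have "(\<integral>\<omega>. Q \<omega> * ft (mollify s ?f) (- \<omega>) \<partial>lborel) = (\<integral>\<omega>. ?h \<omega> * ?\<mu>_hat \<omega> \<partial>lborel)"
  proof (rule integral_cong_AE)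
    have "integrable lborel (mollify s ?f)"
      using Xi_mollify_integrable[OF f s, of 0] by (simp add: Xi_def)
    then have [measurable]: "mollify s ?f \<in> borel_measurable borel"
      using borel_measurable_integrable by auto
    show "(\<lambda>\<omega>. Q \<omega> * ft (mollify s ?f) (- \<omega>)) \<in> borel_measurable lborel"
      using Q(1) by measurable
    interpret sigma_finite_measure \<mu>
      by (rule \<mu>'(1))
    show "(\<lambda>\<omega>. ?h \<omega> * ?\<mu>_hat \<omega>) \<in> borel_measurable lborel"
      by measurable
    show "AE \<omega> in lborel. Q \<omega> * ft (mollify s ?f) (- \<omega>) = ?h \<omega> * ?\<mu>_hat \<omega>"
      using Q(2) by eventually_elim (simp add: ft_mollify[OF f s] ft_f mult_ac)
  qed
  also have "\<dots> = (\<integral>z. ft ?h (- z) \<partial>\<mu>)"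
    by (rule integral_ft_fin_borel[OF \<mu> h, symmetric])
  also have "\<dots> = complex_of_real ((2 * pi) ^ DIM('a)) * (\<integral>z. mollify s lam z \<partial>\<mu>)"
    by (simp only: ft_ft_mult_gauss_ft[OF lam s] integral_mult_right_zero)
  finally show ?thesis
    by (simp add: inv_ft_reg_distr_eq)
qed

lemma Xi_extension_wconv:
  fixes F lam :: "'a::euclidean_space \<Rightarrow> complex"
  assumes \<mu>: "fin_borel \<mu>" and F: "F \<in> Xi k" and lam: "lam \<in> Xi 0"
    and Q: "tempered Q" "AE \<omega> in lborel. Q \<omega> * ft F (- \<omega>) = ft lam \<omega>"
    and L: "Xi_extension k (inv_ft_reg_distr Q) L"
  shows "L (wconv \<mu> (\<lambda>_. 1) F) = (\<integral>z. lam z \<partial>\<mu>)"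
proof (rule LIMSEQ_unique)
  define \<sigma> :: "nat \<Rightarrow> real" where "\<sigma> n = inverse (real (Suc n))" for n
  have \<sigma>: "\<And>n. \<sigma> n > 0" "\<sigma> \<longlonglongrightarrow> 0"
    using LIMSEQ_inverse_real_of_nat by (simp_all add: \<sigma>_def[abs_def])
  have "inv_ft_reg_distr Q (mollify (\<sigma> n) (wconv \<mu> (\<lambda>_. 1) F)) = (\<integral>z. mollify (\<sigma> n) lam z \<partial>\<mu>)" for n
    using Q by (intro inv_ft_reg_distr_mollify_wconv \<mu> Xi_integrable[OF F] Xi_integrable[OF lam] \<sigma>)
      (simp add: tempered_def)
  then show "(\<lambda>n. \<integral>z. mollify (\<sigma> n) lam z \<partial>\<mu>) \<longlonglongrightarrow> L (wconv \<mu> (\<lambda>_. 1) F)"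
    using Xi_extension_eq_lim_mollify[OF Q(1) L Xi_wconv_fin_borel[OF \<mu> F] \<sigma>] by simp
  obtain B where lam_bound: "\<And>x. norm (lam x) \<le> B"
    using C0k_0_bounded[OF Xi_imp_C0k[OF lam]] by blast
  have "(\<lambda>n. \<integral>z. 1 * mollify (\<sigma> n) lam z \<partial>\<mu>) \<longlonglongrightarrow> (\<integral>z. 1 * lam z \<partial>\<mu>)"
  proof (rule tendsto_integral_mult_bounded[OF fin_borelD(3)[OF \<mu>]])
    show "mollify (\<sigma> n) lam \<in> borel_measurable \<mu>" for n
      using C0k_0_borel_measurable[OF Xi_imp_C0k[OF Xi_mollify[OF lam \<sigma>(1)]]]
      by (simp add: measurable_cong_sets[OF fin_borelD(2)[OF \<mu>] refl])
    show "norm (mollify (\<sigma> n) lam x) \<le> B" for n x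
      using norm_wconv_le[OF _ integrable_gauss[OF \<sigma>(1)]
          C0k_0_borel_measurable[OF Xi_imp_C0k[OF lam]] lam_bound] \<sigma>(1)
      by (simp add: mollify_def integral_gauss)
    show "(\<lambda>n. mollify (\<sigma> n) lam x) \<longlonglongrightarrow> lam x" for x
      by (rule mollify_LIMSEQ[OF Xi_imp_C0k[OF lam] \<sigma>])
  qed
  then show "(\<lambda>n. \<integral>z. mollify (\<sigma> n) lam z \<partial>\<mu>) \<longlonglongrightarrow> (\<integral>z. lam z \<partial>\<mu>)"
    by simp
qed

lemma
  assumes M: "prob_space M" and V: "distributed M lborel V (\<lambda>x. ennreal (fV x))"
    and nonneg: "\<And>x. 0 \<le> fV x" and fV: "C0k k fV"
  shows distributed_imp_Xi: "(\<lambda>x. complex_of_real (fV x)) \<in> Xi k"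
    and char_fn_eq_ft: "char_fn M V \<omega> = ft (\<lambda>x. complex_of_real (fV x)) \<omega>"
proof -
  interpret prob_space M by fact
  have [measurable]: "V \<in> borel_measurable M" "fV \<in> borel_measurable borel"
    using distributed_measurable[OF V] C0k_0_borel_measurable[OF C0k_imp_C0k_0[OF fV]] by simp_all
  have distr: "distr M lborel V = density lborel (\<lambda>x. ennreal (fV x))"
    by (rule distributed_distr_eq_density[OF V])
  have "emeasure (distr M lborel V) UNIV = 1"
    by (subst emeasure_distr) (auto simp: emeasure_space_1)
  then have "(\<integral>\<^sup>+ x. ennreal (fV x) \<partial>lborel) = 1"
    unfolding distr by (simp add: emeasure_density)
  then have "integrable lborel fV"
    using nonneg by (intro integrableI_nonneg) auto
  then show "(\<lambda>x. complex_of_real (fV x)) \<in> Xi k"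
    using C0k_bounded_linear[OF bounded_linear_of_real fV] by (simp add: Xi_def)
  have "char_fn M V \<omega> = (\<integral>x. cis (\<omega> \<bullet> x) \<partial>distr M lborel V)"
    unfolding char_fn_def by (subst integral_distr) auto
  also have "\<dots> = (\<integral>x. fV x *\<^sub>R cis (\<omega> \<bullet> x) \<partial>lborel)"
    unfolding distr using nonneg by (subst integral_density) auto
  finally show "char_fn M V \<omega> = ft (\<lambda>x. complex_of_real (fV x)) \<omega>"
    by (simp add: ft_def scaleR_conv_of_real mult.commute)
qed

lemma quotient_mult_AE:
  fixes \<phi> h :: "'a::euclidean_space \<Rightarrow> complex"
  assumes "AE \<omega> in lborel. \<phi> \<omega> \<noteq> 0"
  shows "AE \<omega> in lborel. (if \<phi> (- \<omega>) \<noteq> 0 then h \<omega> / \<phi> (- \<omega>) else 0) * \<phi> (- \<omega>) = h \<omega>"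
  using AE_lborel_uminus[OF assms] by eventually_elim simp

lemma temperedI:
  fixes Q :: "'a::euclidean_space \<Rightarrow> complex"
  assumes [measurable]: "Q \<in> borel_measurable borel"
    and "\<exists>N::nat. (\<integral>\<^sup>+ \<omega>. ennreal (norm (Q \<omega>) / (1 + norm \<omega>) ^ N) \<partial>lborel) < \<infinity>"
  shows "tempered Q"
  using assms unfolding tempered_def by (auto intro!: integrableI_nonneg)

lemma Xi_extension_conv_meas:
  fixes fV lam :: "'a::euclidean_space \<Rightarrow> real"
  assumes \<mu>: "fin_borel \<mu>1" "fin_borel \<mu>2"
    and F: "(\<lambda>x. complex_of_real (fV x)) \<in> Xi k" and lam: "(\<lambda>x. complex_of_real (lam x)) \<in> Xi 0"
    and Q: "tempered Q"
      "AE \<omega> in lborel. Q \<omega> * ft (\<lambda>x. complex_of_real (fV x)) (- \<omega>) = ft (\<lambda>x. complex_of_real (lam x)) \<omega>"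
    and L: "Xi_extension k (inv_ft_reg_distr Q) L"
  shows "(\<lambda>x. complex_of_real (conv_meas fV \<mu>1 \<mu>2 x)) \<in> Xi k"
    and "L (\<lambda>x. complex_of_real (conv_meas fV \<mu>1 \<mu>2 x)) =
      complex_of_real ((\<integral>x. lam x \<partial>\<mu>1) - (\<integral>x. lam x \<partial>\<mu>2))"
proof -
  define f where "f \<mu> = wconv \<mu> (\<lambda>_. 1) (\<lambda>x. complex_of_real (fV x))" for \<mu>
  have conv_meas_eq: "(\<lambda>x. complex_of_real (conv_meas fV \<mu>1 \<mu>2 x)) = (\<lambda>x. 1 * f \<mu>1 x + - 1 * f \<mu>2 x)"
    by (simp add: conv_meas_def f_def wconv_def)
  have f: "f \<mu>1 \<in> Xi k" "f \<mu>2 \<in> Xi k"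
    unfolding f_def by (intro Xi_wconv_fin_borel \<mu> F)+
  then show "(\<lambda>x. complex_of_real (conv_meas fV \<mu>1 \<mu>2 x)) \<in> Xi k"
    unfolding conv_meas_eq by (rule Xi_lincomb)
  have "L (\<lambda>x. 1 * f \<mu>1 x + - 1 * f \<mu>2 x) = 1 * L (f \<mu>1) + - 1 * L (f \<mu>2)"
    using f L unfolding Xi_extension_def by blast
  then show "L (\<lambda>x. complex_of_real (conv_meas fV \<mu>1 \<mu>2 x)) =
      complex_of_real ((\<integral>x. lam x \<partial>\<mu>1) - (\<integral>x. lam x \<partial>\<mu>2))"
    unfolding conv_meas_eq f_def
    by (simp add: Xi_extension_wconv[OF \<mu>(1) F lam Q L] Xi_extension_wconv[OF \<mu>(2) F lam Q L])
qed

theorem theorem2: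
  fixes M :: "'s measure"
    and X V :: "'s \<Rightarrow> 'a::euclidean_space"
    and fV :: "'a \<Rightarrow> real"
    and g :: "'a \<Rightarrow> real"
    and y :: 'a
    and k :: nat
  defines "lam \<equiv> (\<lambda>x. complex_of_real (g x * fV (y - x)))"
  defines "Q \<equiv> (\<lambda>\<omega>. if char_fn M V (- \<omega>) \<noteq> 0 then ft lam \<omega> / char_fn M V (- \<omega>) else 0)"
  assumes "prob_space M"
    and "X \<in> borel_measurable M" and "V \<in> borel_measurable M"
    and "prob_space.indep_var M borel X borel V"
    and "\<forall>x. 0 \<le> fV x"
    and "distributed M lborel V (\<lambda>x. ennreal (fV x))"
    and "C0k k fV"
    and "AE \<omega> in lborel. char_fn M V \<omega> \<noteq> 0"
    and "g \<in> borel_measurable borel"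
    and "lam \<in> Xi 0"
    and "integrable lborel (ft lam)"
    and "\<exists>N::nat. (\<integral>\<^sup>+ \<omega>. ennreal (norm (Q \<omega>) / (1 + norm \<omega>) ^ N) \<partial>lborel) < \<infinity>"
    and "\<exists>C>0. \<forall>\<psi>. schwartz \<psi> \<longrightarrow> norm (inv_ft_reg_distr Q \<psi>) \<le> C * xi_norm k \<psi>"
  shows "(\<exists>L :: ('a \<Rightarrow> complex) \<Rightarrow> complex.
            ((\<forall>\<psi>\<in>Xi k. \<forall>\<phi>\<in>Xi k. \<forall>a b. L (\<lambda>x. a * \<psi> x + b * \<phi> x) = a * L \<psi> + b * L \<phi>) \<and>
             (\<exists>C. \<forall>\<psi>\<in>Xi k. norm (L \<psi>) \<le> C * xi_norm k \<psi>) \<and>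
             (\<forall>\<psi>. schwartz \<psi> \<longrightarrow> L \<psi> = inv_ft_reg_distr Q \<psi>)) \<and>
            (\<forall>L'. ((\<forall>\<psi>\<in>Xi k. \<forall>\<phi>\<in>Xi k. \<forall>a b. L' (\<lambda>x. a * \<psi> x + b * \<phi> x) = a * L' \<psi> + b * L' \<phi>) \<and>
                   (\<exists>C. \<forall>\<psi>\<in>Xi k. norm (L' \<psi>) \<le> C * xi_norm k \<psi>) \<and>
                   (\<forall>\<psi>. schwartz \<psi> \<longrightarrow> L' \<psi> = inv_ft_reg_distr Q \<psi>))
                  \<longrightarrow> (\<forall>\<psi>\<in>Xi k. L' \<psi> = L \<psi>)) \<and>
            (\<forall>\<mu>1 \<mu>2. fin_borel \<mu>1 \<and> fin_borel \<mu>2 \<longrightarrow>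
               (\<lambda>x. complex_of_real (conv_meas fV \<mu>1 \<mu>2 x)) \<in> Xi k \<and>
               L (\<lambda>x. complex_of_real (conv_meas fV \<mu>1 \<mu>2 x)) =
                 complex_of_real ((\<integral>x. g x * fV (y - x) \<partial>\<mu>1) - (\<integral>x. g x * fV (y - x) \<partial>\<mu>2))))
       \<and> (\<forall>\<mu>1 \<mu>2 fs. fin_borel \<mu>1 \<and> fin_borel \<mu>2 \<and> (\<forall>n. schwartz (fs n)) \<and>
            (\<lambda>n. xi_norm k (\<lambda>x. fs n x - complex_of_real (conv_meas fV \<mu>1 \<mu>2 x))) \<longlonglongrightarrow> 0
            \<longrightarrow> (\<lambda>n. inv_ft_reg_distr Q (fs n)) \<longlonglongrightarrow>
                  complex_of_real ((\<integral>x. g x * fV (y - x) \<partial>\<mu>1) - (\<integral>x. g x * fV (y - x) \<partial>\<mu>2)))"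
proof -
  let ?F = "\<lambda>x. complex_of_real (fV x)"
  note F = distributed_imp_Xi[OF assms(3,8) assms(7)[rule_format] assms(9)]
    and \<phi> = char_fn_eq_ft[OF assms(3,8) assms(7)[rule_format] assms(9)]
  have QF: "AE \<omega> in lborel. Q \<omega> * ft ?F (- \<omega>) = ft lam \<omega>"
    unfolding Q_def \<phi> using assms(10) unfolding \<phi> by (rule quotient_mult_AE)
  have [measurable]: "ft ?F \<in> borel_measurable borel" "ft lam \<in> borel_measurable borel"
    using F assms(12) by (auto intro!: borel_measurable_ft dest: Xi_integrable)
  have Q: "tempered Q"
    using assms(14) by (rule temperedI[rotated]) (unfold Q_def \<phi>, measurable)
  obtain C where T_bound: "C > 0" "\<And>\<psi>. schwartz \<psi> \<Longrightarrow> norm (inv_ft_reg_distr Q \<psi>) \<le> C * xi_norm k \<psi>"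
    using assms(15) by blast
  obtain L where L: "Xi_extension k (inv_ft_reg_distr Q) L"
    using Xi_extension_exists[OF Q T_bound(2)] T_bound(1) by auto
  note tweedie = Xi_extension_conv_meas[OF _ _ F assms(12)[unfolded lam_def] Q QF[unfolded lam_def] L]
  have "(\<lambda>n. inv_ft_reg_distr Q (fs n)) \<longlonglongrightarrow>
      complex_of_real ((\<integral>x. g x * fV (y - x) \<partial>\<mu>1) - (\<integral>x. g x * fV (y - x) \<partial>\<mu>2))"
    if "fin_borel \<mu>1" "fin_borel \<mu>2" "\<And>n. schwartz (fs n)"
      "(\<lambda>n. xi_norm k (\<lambda>x. fs n x - complex_of_real (conv_meas fV \<mu>1 \<mu>2 x))) \<longlonglongrightarrow> 0" for \<mu>1 \<mu>2 fs
    using Xi_extension_LIMSEQ_schwartz[OF L tweedie(1) that(3,4)] that by (simp add: tweedie(2))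
  with L Xi_extension_unique[OF _ L] tweedie show ?thesis
    unfolding Xi_extension_def[symmetric] by blast
qed

end
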